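(* Let $\mathbb K$ be an algebraically closed field of characteristic zero, let $A=(a,b)\in\mathbb K^2$ and $d\in\mathbb K\setminus\{0\}$, and let $\mathcal C\subset\mathbb K^2$ be a rational affine plane algebraic curve which is neither of the two lines $y_1\pm\sqrt{-1}\,y_2=0$, is not the circle $(y_1-a)^2+(y_2-b)^2=d^2$, and is not a line through $A$. Then the conchoid $\mathfrak C(\mathcal C)$ of $\mathcal C$ from the focus $A$ and distance $d$ is either rational, or it is reducible with two rational components, or it is irreducible but non-rational.
   Context: Let $f$ be the irreducible defining polynomial of $\mathcal C$. For $P=(P_1,P_2)$ write $\|P\|^2=P_1^2+P_2^2$ (no conjugation). The conchoid $\mathfrak C(\mathcal C)$ is the Zariski closure in $\mathbb K^2$ of the set of points $\bar x\in\mathbb K^2$ for which there exist $\bar y\in\mathbb K^2$ and $\lambda\in\mathbb K$ with $f(\bar y)=0$, $\|\bar x-\bar y\|^2=d^2$ and $\bar x=A+\lambda(\bar y-A)$. A (rational) parametrization of an irreducible plane curve is a pair of rational functions in $\mathbb K(t)^2$, not both constant, whose values are Zariski dense in the curve; a curve is rational if it is irreducible and has a parametrization. Components of a plane curve are its irreducible components over $\mathbb K$. *)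

theory Defs
  imports "HOL-Computational_Algebra.Computational_Algebra"
begin

text \<open>A bivariate polynomial is an element of K[X][Y]: the outer variable is the second
  coordinate, the inner variable is the first.\<close>

definition eval2 :: "'a::comm_ring_1 poly poly \<Rightarrow> 'a \<times> 'a \<Rightarrow> 'a" where
  "eval2 f P = poly (poly f [:snd P:]) (fst P)"

definition zero_locus :: "'a::comm_ring_1 poly poly set \<Rightarrow> ('a \<times> 'a) set" where
  "zero_locus F = {P. \<forall>f\<in>F. eval2 f P = 0}"

definition zariski_closed :: "('a::comm_ring_1 \<times> 'a) set \<Rightarrow> bool" where
  "zariski_closed V \<longleftrightarrow> (\<exists>F. V = zero_locus F)"

definition zariski_closure :: "('a::comm_ring_1 \<times> 'a) set \<Rightarrow> ('a \<times> 'a) set" where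
  "zariski_closure S = zariski_closed hull S"

definition zariski_irreducible :: "('a::comm_ring_1 \<times> 'a) set \<Rightarrow> bool" where
  "zariski_irreducible V \<longleftrightarrow> zariski_closed V \<and> V \<noteq> {} \<and>
     (\<forall>V1 V2. zariski_closed V1 \<and> zariski_closed V2 \<and> V = V1 \<union> V2 \<longrightarrow> V1 = V \<or> V2 = V)"

definition irreducible_components :: "('a::comm_ring_1 \<times> 'a) set \<Rightarrow> ('a \<times> 'a) set set" where
  "irreducible_components V =
     {Z. Z \<subseteq> V \<and> zariski_irreducible Z \<and>
         (\<forall>Z'. Z' \<subseteq> V \<and> zariski_irreducible Z' \<and> Z \<subseteq> Z' \<longrightarrow> Z' = Z)}"

definition plane_curve :: "('a::comm_ring_1 \<times> 'a) set \<Rightarrow> bool" where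
  "plane_curve V \<longleftrightarrow> (\<exists>f. (\<nexists>c. f = [:[:c:]:]) \<and> V = zero_locus {f})"

text \<open>The rational function r is regular at t with value v. The fraction p/q need not be
  reduced: any representation whose denominator does not vanish at t may be used, and all of
  them give the same v.\<close>

definition rat_value :: "'a::field poly fract \<Rightarrow> 'a \<Rightarrow> 'a \<Rightarrow> bool" where
  "rat_value r t v \<longleftrightarrow> (\<exists>p q. r = Fract p q \<and> poly q t \<noteq> 0 \<and> v = poly p t / poly q t)"

definition rat_constant :: "'a::field poly fract \<Rightarrow> bool" where
  "rat_constant r \<longleftrightarrow> (\<exists>c. r = to_fract [:c:])"

definition parametrizes :: "'a::field poly fract \<times> 'a poly fract \<Rightarrow> ('a \<times> 'a) set \<Rightarrow> bool" where
  "parametrizes \<phi> V \<longleftrightarrow> \<not> (rat_constant (fst \<phi>) \<and> rat_constant (snd \<phi>)) \<and>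
     zariski_closure {(x, y). \<exists>t. rat_value (fst \<phi>) t x \<and> rat_value (snd \<phi>) t y} = V"

definition rational_curve :: "('a::field \<times> 'a) set \<Rightarrow> bool" where
  "rational_curve V \<longleftrightarrow> plane_curve V \<and> zariski_irreducible V \<and> (\<exists>\<phi>. parametrizes \<phi> V)"

definition sqnorm :: "'a::comm_ring_1 \<times> 'a \<Rightarrow> 'a" where
  "sqnorm P = fst P ^ 2 + snd P ^ 2"

definition conchoid :: "'a::comm_ring_1 poly poly \<Rightarrow> 'a \<times> 'a \<Rightarrow> 'a \<Rightarrow> ('a \<times> 'a) set" where
  "conchoid f A d = zariski_closure
     {(x1, x2). \<exists>y1 y2 l. eval2 f (y1, y2) = 0 \<and> sqnorm (x1 - y1, x2 - y2) = d ^ 2 \<and>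
        x1 = fst A + l * (y1 - fst A) \<and> x2 = snd A + l * (y2 - snd A)}"

end

theory Submission
  imports Defs
begin

text \<open>Let \<open>A = (a, b)\<close> and
  \<open>N(y) = \<parallel>y - A\<parallel>\<^sup>2\<close>.  A point \<open>y\<close> of the
  curve with \<open>N(y) \<noteq> 0\<close> has the two conchoid points
  \<open>y + \<mu>(y - A)\<close> with \<open>\<mu>\<^sup>2 N(y) = d\<^sup>2\<close>, and a
  point with \<open>N(y) = 0\<close> has none because \<open>d \<noteq> 0\<close>.  Pull
  \<open>N\<close> back along the parametrization to a rational function \<open>n\<close> in
  \<open>K(t)\<close>; it is not zero since the curve is not one of the two isotropic lines through
  \<open>A\<close>.

  If \<open>n\<close> is not a square in \<open>K(t)\<close>, almost all conchoid points lie in the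
  image of the irreducible curve \<open>\<mu>\<^sup>2 n(t) = d\<^sup>2\<close>, and the conchoid
  is irreducible (\<open>prime_vanishing_conchoid_points\<close>); whether it is rational is then
  left open.  If \<open>n = m\<^sup>2\<close>, the two signs of \<open>\<mu> = d / m\<close>
  give two rational parametrizations, and the conchoid is the union of two rational curves, which
  may coincide (\<open>conchoid_split_case\<close>).

  Three further points need proof.  The conchoid must be a curve: it is neither finite, because
  infinitely many points of the curve share a conchoid point only on a line through \<open>A\<close>
  or on the circle of radius \<open>d\<close> (\<open>finite_fibre\<close>), nor dense, because its
  points satisfy an explicit polynomial equation (\<open>conchoid_equation\<close>); and an
  irreducible closed set between these extremes is the locus of one polynomial
  (\<open>prime_vanishing_principal\<close>).  Points of the curve missed by the parametrization
  must not contribute extra components (\<open>vanishes_on_conchoid_if_infinite\<close>).  Both,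
  and the irreducibility above, rest on \<open>conjugate_split\<close>: reduced modulo the equation
  of \<open>\<mu>\<close>, a polynomial at a conchoid point becomes
  \<open>U(y) + \<mu> V(y)\<close>.  Finally, the two branches are the components once they
  differ, as neither contains the other
  (\<open>prime_vanishing_no_proper_inclusion\<close>).\<close>

section \<open>Vanishing ideals and Zariski closures\<close>

lemma eval2_simps [simp]:
  "eval2 0 P = 0" "eval2 1 P = 1"
  "eval2 [:[:c:]:] P = c" "eval2 [:[:0, 1:]:] P = fst P" "eval2 [:0, 1:] P = snd P"
  "eval2 (g + h) P = eval2 g P + eval2 h P"
  "eval2 (g - h) P = eval2 g P - eval2 h P"
  "eval2 (g * h) P = eval2 g P * eval2 h P"
  "eval2 (g ^ n) P = eval2 g P ^ n"
  "eval2 (smult p g) P = poly p (fst P) * eval2 g P"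
  for P :: "'a::comm_ring_1 \<times> 'a"
  by (simp_all add: eval2_def)

text \<open>\<open>K[X][Y]\<close> is generated as a ring by the constants and the two coordinate
  functions.  This induction carries identities on generators over to all polynomials, both when
  rational functions of \<open>t\<close> are substituted for the coordinates and when the two
  conchoid points of a point of the curve are.\<close>

lemma bivariate_induct [case_names const X Y add mult]:
  fixes g :: "'a::comm_ring_1 poly poly"
  assumes const: "\<And>c. Q [:[:c:]:]" and X: "Q [:[:0, 1:]:]" and Y: "Q [:0, 1:]"
    and add: "\<And>g h. Q g \<Longrightarrow> Q h \<Longrightarrow> Q (g + h)"
    and mult: "\<And>g h. Q g \<Longrightarrow> Q h \<Longrightarrow> Q (g * h)"
  shows "Q g"
proof (induction g)
  case 0
  show ?case using const[of 0] by simp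
next
  case (pCons p g)
  have inner: "Q [:p:]"
  proof (induction p)
    case 0
    show ?case using const[of 0] by simp
  next
    case (pCons c p)
    have "[:pCons c p:] = [:[:c:]:] + [:[:0, 1:]:] * [:p:]" by simp
    then show ?case using add[OF const mult[OF X pCons.IH]] by simp
  qed
  have "pCons p g = [:p:] + [:0, 1:] * g" by simp
  then show ?case using add[OF inner mult[OF Y pCons.IH]] by simp
qed

definition vanishes_on :: "'a::comm_ring_1 poly poly \<Rightarrow> ('a \<times> 'a) set \<Rightarrow> bool" where
  "vanishes_on g S \<longleftrightarrow> (\<forall>P\<in>S. eval2 g P = 0)"

definition prime_vanishing :: "('a::comm_ring_1 \<times> 'a) set \<Rightarrow> bool" where
  "prime_vanishing S \<longleftrightarrow> (\<forall>g h. vanishes_on (g * h) S \<longrightarrow> vanishes_on g S \<or> vanishes_on h S)"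

lemma vanishes_on_iff_subset: "vanishes_on g S \<longleftrightarrow> S \<subseteq> zero_locus {g}"
  by (auto simp: vanishes_on_def zero_locus_def)

lemma zariski_closed_zero_locus [simp]: "zariski_closed (zero_locus F)"
  by (auto simp: zariski_closed_def)

lemma zariski_closure_eq: "zariski_closure S = zero_locus {g. vanishes_on g S}"
  unfolding zariski_closure_def
proof (rule hull_unique)
  show "S \<subseteq> zero_locus {g. vanishes_on g S}"
    by (auto simp: zero_locus_def vanishes_on_def)
  show "zero_locus {g. vanishes_on g S} \<subseteq> V" if "S \<subseteq> V" "zariski_closed V" for V
    using that by (auto simp: zero_locus_def vanishes_on_def zariski_closed_def)
qed simp

lemma zariski_closed_closure [simp]: "zariski_closed (zariski_closure S)"
  by (simp add: zariski_closure_eq)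

lemma subset_zariski_closure: "S \<subseteq> zariski_closure S"
  by (auto simp: zariski_closure_def intro: hull_inc)

lemma zariski_closure_minimal: "S \<subseteq> V \<Longrightarrow> zariski_closed V \<Longrightarrow> zariski_closure S \<subseteq> V"
  by (simp add: zariski_closure_def hull_minimal)

lemma vanishes_on_closure [simp]: "vanishes_on g (zariski_closure S) \<longleftrightarrow> vanishes_on g S"
  by (meson order_trans subset_zariski_closure vanishes_on_iff_subset zariski_closed_zero_locus
      zariski_closure_minimal)

lemma prime_vanishing_closure [simp]:
  "prime_vanishing (zariski_closure S) \<longleftrightarrow> prime_vanishing S"
  by (simp add: prime_vanishing_def)

lemma zariski_closed_subsetI:
  assumes "zariski_closed V" "\<And>g. vanishes_on g V \<Longrightarrow> vanishes_on g S"
  shows "S \<subseteq> V"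
proof -
  obtain F where F: "V = zero_locus F" using assms(1) by (auto simp: zariski_closed_def)
  then have "vanishes_on g S" if "g \<in> F" for g
    using that by (intro assms(2)) (auto simp: vanishes_on_def zero_locus_def)
  then show ?thesis by (auto simp: F vanishes_on_def zero_locus_def)
qed

lemma zariski_closed_Un:
  fixes V W :: "('a::idom \<times> 'a) set"
  assumes "zariski_closed V" "zariski_closed W"
  shows "zariski_closed (V \<union> W)"
proof -
  obtain F G where "V = zero_locus F" "W = zero_locus G"
    using assms by (auto simp: zariski_closed_def)
  moreover have "zero_locus F \<union> zero_locus G = zero_locus {f * g |f g. f \<in> F \<and> g \<in> G}"
  proof (intro equalityI subsetI)
    fix P assume "P \<in> zero_locus {f * g |f g. f \<in> F \<and> g \<in> G}"
    then have "\<forall>f\<in>F. \<forall>g\<in>G. eval2 (f * g) P = 0" unfolding zero_locus_def by blast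
    then show "P \<in> zero_locus F \<union> zero_locus G" by (auto simp: zero_locus_def)
  qed (auto simp: zero_locus_def)
  ultimately have "V \<union> W = zero_locus {f * g |f g. f \<in> F \<and> g \<in> G}" by simp
  then show ?thesis by simp
qed

lemma zariski_irreducible_iff_prime:
  fixes V :: "('a::idom \<times> 'a) set"
  assumes "zariski_closed V" "V \<noteq> {}" "prime_vanishing V"
  shows "zariski_irreducible V"
  unfolding zariski_irreducible_def
proof (intro conjI allI impI)
  fix V1 V2 assume *: "zariski_closed V1 \<and> zariski_closed V2 \<and> V = V1 \<union> V2"
  show "V1 = V \<or> V2 = V"
  proof (rule ccontr)
    assume "\<not> ?thesis"
    then have "\<not> V \<subseteq> V1" "\<not> V \<subseteq> V2" using * by auto
    then obtain g h where "vanishes_on g V1" "\<not> vanishes_on g V" "vanishes_on h V2" "\<not> vanishes_on h V"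
      using * zariski_closed_subsetI by metis
    moreover have "vanishes_on (g * h) V"
      using * calculation by (auto simp: vanishes_on_def)
    ultimately show False using assms(3) by (auto simp: prime_vanishing_def)
  qed
qed (use assms in auto)

text \<open>Over an algebraically closed field a polynomial in \<open>X\<close> alone is a product
  of linear factors \<open>X - c\<close>, which are prime in \<open>K[X][Y]\<close>; they can be
  cancelled one by one. This takes the place of the lemma of Gauss on primitive polynomials.\<close>

lemma dvd_cancel_univariate:
  fixes g h :: "'a::alg_closed_field poly poly"
  assumes "l \<noteq> 0" "h dvd [:l:] * g" "\<And>c. \<not> [:[:-c, 1:]:] dvd h"
  shows "h dvd g"
  using assms(1,2)
proof (induction "degree l" arbitrary: l)
  case 0
  then obtain c where l: "l = [:c:]" "c \<noteq> 0" by (metis degree_0_id pCons_eq_0_iff degree_eq_zeroE)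
  have "g = [:[:inverse c:]:] * ([:l:] * g)"
    using l by (simp add: pCons_one)
  then show ?case using 0(3) by (metis dvd_mult)
next
  case (Suc n)
  then obtain c where "poly l c = 0" using alg_closed_imp_poly_has_root[of l] by auto
  then obtain l' where l': "l = [:-c, 1:] * l'" using poly_eq_0_iff_dvd by (metis dvdE)
  then have "l' \<noteq> 0" using Suc.prems by auto
  then have deg: "degree l' = n" using Suc.hyps(2) l' by (simp add: degree_mult_eq del: mult_pCons_left)
  have L: "[:l:] = [:[:-c, 1:]:] * [:l':]" using l' by simp
  obtain q where q: "[:l:] * g = h * q" using Suc.prems by auto
  have pr: "prime_elem [:[:-c, 1:]:]"
    by (intro lift_prime_elem_poly prime_elem_linear_field_poly) simp
  have "[:[:-c, 1:]:] dvd h * q"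
    unfolding q[symmetric] L by (metis dvd_triv_left mult.assoc)
  then obtain q' where q': "q = [:[:-c, 1:]:] * q'"
    using pr assms(3) by (meson prime_elem_dvd_mult_iff dvdE)
  have "[:[:-c, 1:]:] * ([:l':] * g) = [:[:-c, 1:]:] * (h * q')"
    using q unfolding L q' by (simp only: mult_ac)
  then have "[:l':] * g = h * q'"
    using pr by (simp only: mult_cancel_left) auto
  then show ?case using Suc.hyps(1)[of l'] deg \<open>l' \<noteq> 0\<close> by auto
qed

lemma prime_vanishing_univariate:
  fixes p :: "'a::alg_closed_field poly"
  assumes "prime_vanishing S" "S \<noteq> {}" "p \<noteq> 0" "vanishes_on [:p:] S"
  obtains c where "vanishes_on [:[:-c, 1:]:] S"
  using assms(3,4)
proof (induction "degree p" arbitrary: p thesis)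
  case 0
  then obtain c where "p = [:c:]" "c \<noteq> 0" by (metis pCons_eq_0_iff degree_eq_zeroE)
  then show ?case using 0 assms(2) by (auto simp: vanishes_on_def)
next
  case (Suc n)
  then obtain c where "poly p c = 0" using alg_closed_imp_poly_has_root[of p] by auto
  then obtain p' where p': "p = [:-c, 1:] * p'" using poly_eq_0_iff_dvd by (metis dvdE)
  then have "p' \<noteq> 0" using Suc.prems by auto
  then have "degree p' = n" using Suc.hyps(2) p' by (simp add: degree_mult_eq del: mult_pCons_left)
  moreover have "[:p:] = [:[:-c, 1:]:] * [:p':]" using p' by simp
  ultimately show ?case using Suc \<open>p' \<noteq> 0\<close> assms(1) unfolding prime_vanishing_def by metis
qed

text \<open>An irreducible closed set strictly between a point and the plane is a hypersurface.
  The generator of its ideal is an element of least degree in \<open>Y\<close> whose leading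
  coefficient has least degree in \<open>X\<close>: pseudo-division by it leaves remainder zero, and
  the factor introduced by pseudo-division cancels because no \<open>X - c\<close> divides such a
  generator.  Vertical lines, where there is no positive degree in \<open>Y\<close> to divide by,
  are treated apart.\<close>

lemma prime_vanishing_principal:
  fixes S :: "('a::alg_closed_field \<times> 'a) set"
  assumes S: "infinite S" "prime_vanishing S" and g0: "g0 \<noteq> 0" "vanishes_on g0 S"
  obtains h where "h \<noteq> 0" "\<And>g. vanishes_on g S \<longleftrightarrow> h dvd g"
proof (cases "\<exists>p. p \<noteq> 0 \<and> vanishes_on [:p:] S")
  case True
  then obtain c where c: "vanishes_on [:[:-c, 1:]:] S"
    using prime_vanishing_univariate[OF S(2)] S(1) by (metis infinite_imp_nonempty)
  then have fst: "fst P = c" if "P \<in> S" for P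
    using that by (auto simp: vanishes_on_def eval2_def)
  have "[:[:-c, 1:]:] dvd g" if g: "vanishes_on g S" for g
  proof -
    define q where "q = map_poly (\<lambda>p. poly p c) g"
    have q: "poly q y = eval2 g (c, y)" for y
      unfolding q_def eval2_def by (induction g) (auto simp: map_poly_pCons)
    have "inj_on snd S" using fst by (metis inj_onI prod_eqI)
    then have "infinite (snd ` S)" using S(1) finite_imageD by blast
    moreover have "snd ` S \<subseteq> {y. poly q y = 0}"
      using g fst by (auto simp: q vanishes_on_def)
    ultimately have "q = 0" using poly_roots_finite[of q] finite_subset by blast
    then have "poly (coeff g n) c = 0" for n
      using coeff_map_poly[of "\<lambda>p. poly p c" g n] by (simp add: q_def)
    then show ?thesis by (simp add: const_poly_dvd_iff poly_eq_0_iff_dvd)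
  qed
  moreover have "vanishes_on g S" if "[:[:-c, 1:]:] dvd g" for g
    using that c by (auto simp: vanishes_on_def elim!: dvdE simp del: mult_pCons_left)
  ultimately show ?thesis using that[of "[:[:-c, 1:]:]"] by auto
next
  case False
  define J where "J = {g. g \<noteq> 0 \<and> vanishes_on g S}"
  obtain h0 where h0: "h0 \<in> J" "\<And>g. g \<in> J \<Longrightarrow> degree h0 \<le> degree g"
    using ex_has_least_nat[of "\<lambda>g. g \<in> J" g0 degree] g0 by (auto simp: J_def)
  obtain h where h: "h \<in> J" "degree h = degree h0"
    and min: "\<And>g. g \<in> J \<Longrightarrow> degree g = degree h0 \<Longrightarrow> degree (lead_coeff h) \<le> degree (lead_coeff g)"
    using ex_has_least_nat[of "\<lambda>g. g \<in> J \<and> degree g = degree h0" h0 "\<lambda>g. degree (lead_coeff g)"] h0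
    by auto
  have h_nz: "h \<noteq> 0" and h_van: "vanishes_on h S" using h by (auto simp: J_def)
  have prim: "\<not> [:[:-c, 1:]:] dvd h" for c
  proof
    assume "[:[:-c, 1:]:] dvd h"
    then obtain h' where h': "h = [:[:-c, 1:]:] * h'" by auto
    have "\<not> vanishes_on [:[:-c, 1:]:] S" using False by (metis pCons_eq_0_iff one_neq_zero)
    moreover have "vanishes_on ([:[:-c, 1:]:] * h') S" using h_van h' by (simp only:)
    ultimately have "vanishes_on h' S" using S(2) unfolding prime_vanishing_def by blast
    moreover have "h' \<noteq> 0" using h_nz h' by auto
    ultimately have "h' \<in> J" by (simp add: J_def)
    moreover have deg: "degree h = degree h'" using h' by simp
    moreover have "lead_coeff h = [:-c, 1:] * lead_coeff h'" using h' deg by simp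
    then have "degree (lead_coeff h) = Suc (degree (lead_coeff h'))"
      using h_nz h' by (subst \<open>lead_coeff h = _\<close>, subst degree_mult_eq) auto
    ultimately show False using min[of h'] h(2) by auto
  qed
  have "h dvd g" if g: "vanishes_on g S" for g
  proof -
    define r where "r = pseudo_mod g h"
    obtain l q where lq: "l \<noteq> 0" "smult l g = h * q + r"
      using pseudo_mod(1)[OF h_nz, of g] unfolding r_def by auto
    have "r = [:l:] * g - h * q" using lq by simp
    then have "vanishes_on r S" using g h_van by (simp add: vanishes_on_def del: mult_pCons_left)
    then have "r = 0"
      using pseudo_mod(2)[OF h_nz, of g] h0(2)[of r] h(2) unfolding r_def[symmetric] J_def
      by (force simp: not_le[symmetric])
    then have "h dvd [:l:] * g" using lq by auto
    then show ?thesis using dvd_cancel_univariate lq(1) prim by blast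
  qed
  moreover have "vanishes_on g S" if "h dvd g" for g
    using that h_van by (auto simp: vanishes_on_def)
  ultimately show ?thesis using that[OF h_nz] by blast
qed

lemma prime_vanishing_curve:
  fixes S :: "('a::alg_closed_field \<times> 'a) set"
  assumes S: "infinite S" "prime_vanishing S" and g0: "g0 \<noteq> 0" "vanishes_on g0 S"
  shows "plane_curve (zariski_closure S)" "zariski_irreducible (zariski_closure S)"
proof -
  obtain h where h: "h \<noteq> 0" "\<And>g. vanishes_on g S \<longleftrightarrow> h dvd g"
    by (rule prime_vanishing_principal[OF assms]) (rule that)
  obtain P where P: "P \<in> S" using S(1) by (metis all_not_in_conv infinite_imp_nonempty)
  have "h \<noteq> [:[:c:]:]" for c
  proof
    assume hc: "h = [:[:c:]:]"
    have "vanishes_on h S" using h(2)[of h] by simp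
    then have "eval2 h P = 0" using P unfolding vanishes_on_def by blast
    then have "c = 0" using hc by simp
    then show False using hc h(1) by simp
  qed
  moreover have "zariski_closure S = zero_locus {h}"
    unfolding zariski_closure_eq h(2) by (auto simp: zero_locus_def)
  ultimately show "plane_curve (zariski_closure S)" by (auto simp: plane_curve_def)
  show "zariski_irreducible (zariski_closure S)"
    using subset_zariski_closure[of S] S P by (intro zariski_irreducible_iff_prime) auto
qed

text \<open>Irreducible curves have the same dimension.  In terms of ideals: if \<open>h1\<close>
  generates the ideal of \<open>V\<close> and \<open>h2\<close> that of \<open>W\<close>, then
  \<open>h1\<close> divides \<open>h2\<close>, and the ideal of \<open>W\<close> being prime, it
  contains \<open>h1\<close> or the cofactor; the latter would make \<open>h1\<close> a
  unit.\<close>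

lemma prime_vanishing_no_proper_inclusion:
  fixes V W :: "('a::alg_closed_field \<times> 'a) set"
  assumes V: "infinite V" "prime_vanishing V" and W: "infinite W" "prime_vanishing W" "zariski_closed W"
    "zariski_closed V"
    and g: "g \<noteq> 0" "vanishes_on g W" and sub: "V \<subseteq> W"
  shows "V = W"
proof -
  obtain h1 where h1: "h1 \<noteq> 0" "\<And>g. vanishes_on g V \<longleftrightarrow> h1 dvd g"
    by (rule prime_vanishing_principal[OF V g(1)]) (use g(2) sub in \<open>auto simp: vanishes_on_def\<close>)
  obtain h2 where h2: "h2 \<noteq> 0" "\<And>g. vanishes_on g W \<longleftrightarrow> h2 dvd g"
    by (rule prime_vanishing_principal[OF W(1,2) g]) (rule that)
  have "vanishes_on h2 V" using h2(2)[of h2] sub by (auto simp: vanishes_on_def)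
  then obtain q where q: "h2 = h1 * q" using h1(2)[of h2] by auto
  have "\<not> h2 dvd q"
  proof
    assume "h2 dvd q"
    then obtain s where "q = h2 * s" by auto
    then have "h2 = h2 * (h1 * s)" using q by (simp add: mult_ac)
    then have "h1 * s = 1" using h2(1) by auto
    then have "h1 dvd 1" by (metis dvd_triv_left)
    then have "vanishes_on 1 V" using h1(2)[of 1] by simp
    then have "V = {}" by (auto simp: vanishes_on_def)
    then show False using V(1) by simp
  qed
  moreover have "vanishes_on (h1 * q) W" using h2(2)[of h2] q by simp
  ultimately have "vanishes_on h1 W"
    using W(2) h2(2)[of q] unfolding prime_vanishing_def by blast
  then have "h2 dvd h1" using h2 by simp
  then have "vanishes_on k W" if "vanishes_on k V" for k
    using that h1 h2 by (meson dvd_trans)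
  then show ?thesis using zariski_closed_subsetI[OF W(4)] sub by blast
qed

lemma irreducible_components_Un:
  fixes V W :: "('a::idom \<times> 'a) set"
  assumes V: "zariski_irreducible V" and W: "zariski_irreducible W"
    and "\<not> V \<subseteq> W" "\<not> W \<subseteq> V"
  shows "irreducible_components (V \<union> W) = {V, W}" "\<not> zariski_irreducible (V \<union> W)"
proof -
  have cover: "Z \<subseteq> V \<or> Z \<subseteq> W" if Z: "Z \<subseteq> V \<union> W" "zariski_irreducible Z" for Z
  proof -
    have inter: "zariski_closed (Z \<inter> U)" if U: "zariski_closed U" for U
    proof -
      obtain F where "Z = zero_locus F"
        using Z(2) unfolding zariski_irreducible_def zariski_closed_def by blast
      moreover obtain G where "U = zero_locus G"
        using U unfolding zariski_closed_def by blast
      ultimately have "Z \<inter> U = zero_locus (F \<union> G)" by (auto simp: zero_locus_def)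
      then show ?thesis by simp
    qed
    have "Z = (Z \<inter> V) \<union> (Z \<inter> W)" using Z by auto
    moreover have "zariski_closed (Z \<inter> V)" "zariski_closed (Z \<inter> W)"
      using inter V W by (simp_all add: zariski_irreducible_def)
    moreover have "\<forall>Z1 Z2. zariski_closed Z1 \<and> zariski_closed Z2 \<and> Z = Z1 \<union> Z2 \<longrightarrow> Z1 = Z \<or> Z2 = Z"
      using Z(2) by (simp add: zariski_irreducible_def)
    ultimately have "Z \<inter> V = Z \<or> Z \<inter> W = Z" by (elim allE[of _ "Z \<inter> V"] allE[of _ "Z \<inter> W"]) simp
    then show ?thesis by auto
  qed
  show "irreducible_components (V \<union> W) = {V, W}"
  proof (intro equalityI subsetI)
    fix Z assume "Z \<in> irreducible_components (V \<union> W)"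
    then have Z: "Z \<subseteq> V \<union> W" "zariski_irreducible Z"
      "\<And>Z'. Z' \<subseteq> V \<union> W \<Longrightarrow> zariski_irreducible Z' \<Longrightarrow> Z \<subseteq> Z' \<Longrightarrow> Z' = Z"
      by (auto simp: irreducible_components_def)
    then show "Z \<in> {V, W}" using cover[OF Z(1,2)] Z(3)[of V] Z(3)[of W] V W by auto
  next
    fix Z assume "Z \<in> {V, W}"
    moreover have "Z' = V" if "Z' \<subseteq> V \<union> W" "zariski_irreducible Z'" "V \<subseteq> Z'" for Z'
      using cover[OF that(1,2)] that assms(3) by auto
    moreover have "Z' = W" if "Z' \<subseteq> V \<union> W" "zariski_irreducible Z'" "W \<subseteq> Z'" for Z'
      using cover[OF that(1,2)] that assms(4) by auto
    ultimately show "Z \<in> irreducible_components (V \<union> W)"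
      using V W by (auto simp: irreducible_components_def)
  qed
  show "\<not> zariski_irreducible (V \<union> W)"
    using cover[of "V \<union> W"] assms(3,4) by auto
qed

lemma plane_curve_Un:
  fixes V W :: "('a::idom \<times> 'a) set"
  assumes "plane_curve V" "plane_curve W"
  shows "plane_curve (V \<union> W)"
proof -
  obtain f g where fg: "V = zero_locus {f}" "W = zero_locus {g}"
    and nc: "\<nexists>c. f = [:[:c:]:]" "\<nexists>c. g = [:[:c:]:]"
    using assms by (auto simp: plane_curve_def)
  have "f * g \<noteq> [:[:c:]:]" for c
  proof
    assume eq: "f * g = [:[:c:]:]"
    have nz: "f \<noteq> 0" "g \<noteq> 0" using nc by (metis pCons_0_0)+
    have "degree f + degree g = 0" using nz degree_mult_eq[of f g] eq by simp
    then obtain p q where pq: "f = [:p:]" "g = [:q:]" by (metis add_is_0 degree_eq_zeroE)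
    then have "p * q = [:c:]" "p \<noteq> 0" "q \<noteq> 0" using eq nz by (auto simp: mult.commute)
    then have "degree p + degree q = 0" using degree_mult_eq[of p q] by simp
    then show False using nc pq by (metis add_is_0 degree_eq_zeroE)
  qed
  moreover have "V \<union> W = zero_locus {f * g}" by (auto simp: fg zero_locus_def)
  ultimately show ?thesis unfolding plane_curve_def by blast
qed

section \<open>Values of rational functions and rational images\<close>

abbreviation const_rat :: "'a::field \<Rightarrow> 'a poly fract" where
  "const_rat c \<equiv> to_fract [:c:]"

lemma rat_value_unique:
  assumes "rat_value r t v" "rat_value r t w"
  shows "v = w"
proof -
  obtain p q p' q' where *: "r = Fract p q" "poly q t \<noteq> 0" "v = poly p t / poly q t"
    "r = Fract p' q'" "poly q' t \<noteq> 0" "w = poly p' t / poly q' t"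
    using assms unfolding rat_value_def by blast
  then have "q \<noteq> 0" "q' \<noteq> 0" by auto
  then have "p * q' = p' * q" using * by (simp add: eq_fract)
  then have "poly p t * poly q' t = poly p' t * poly q t" by (metis poly_mult)
  then show ?thesis using *(2,3,5,6) by (simp add: frac_eq_eq)
qed

lemma rat_value_const: "rat_value (const_rat c) t c"
  unfolding rat_value_def to_fract_def by (rule exI[of _ "[:c:]"], rule exI[of _ 1]) simp

lemma rat_value_ident: "rat_value (to_fract [:0, 1:]) t t"
  unfolding rat_value_def to_fract_def by (rule exI[of _ "[:0, 1:]"], rule exI[of _ 1]) simp

lemma rat_value_add:
  assumes "rat_value r t v" "rat_value s t w"
  shows "rat_value (r + s) t (v + w)"
proof -
  obtain p q p' q' where *: "r = Fract p q" "poly q t \<noteq> 0" "v = poly p t / poly q t"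
    "s = Fract p' q'" "poly q' t \<noteq> 0" "w = poly p' t / poly q' t"
    using assms unfolding rat_value_def by blast
  then have "r + s = Fract (p * q' + p' * q) (q * q')" by (auto intro!: add_fract)
  then show ?thesis unfolding rat_value_def
    using * by - (rule exI[of _ "p * q' + p' * q"], rule exI[of _ "q * q'"], simp add: add_frac_eq)
qed

lemma rat_value_mult:
  assumes "rat_value r t v" "rat_value s t w"
  shows "rat_value (r * s) t (v * w)"
proof -
  obtain p q p' q' where *: "r = Fract p q" "poly q t \<noteq> 0" "v = poly p t / poly q t"
    "s = Fract p' q'" "poly q' t \<noteq> 0" "w = poly p' t / poly q' t"
    using assms unfolding rat_value_def by blast
  then show ?thesis unfolding rat_value_def
    by - (rule exI[of _ "p * p'"], rule exI[of _ "q * q'"], simp)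
qed

lemma rat_value_inverse:
  assumes "rat_value r t v" "v \<noteq> 0"
  shows "rat_value (inverse r) t (inverse v)"
proof -
  obtain p q where *: "r = Fract p q" "poly q t \<noteq> 0" "v = poly p t / poly q t"
    using assms unfolding rat_value_def by blast
  then show ?thesis unfolding rat_value_def
    using assms(2) by - (rule exI[of _ q], rule exI[of _ p], simp)
qed

lemma rat_value_diff:
  assumes "rat_value r t v" "rat_value s t w"
  shows "rat_value (r - s) t (v - w)"
proof -
  have "const_rat (-1) = - (1 :: 'a poly fract)"
    by (metis pCons_one minus_pCons minus_zero to_fract_1 to_fract_uminus)
  then show ?thesis
    using rat_value_add[OF assms(1) rat_value_mult[OF rat_value_const[of "-1"] assms(2)]] by simp
qed

lemma rat_value_divide:
  assumes "rat_value r t v" "rat_value s t w" "w \<noteq> 0"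
  shows "rat_value (r / s) t (v / w)"
  using rat_value_mult[OF assms(1) rat_value_inverse[OF assms(2,3)]] by (simp add: field_simps)

lemma rat_value_power: "rat_value r t v \<Longrightarrow> rat_value (r ^ n) t (v ^ n)"
proof (induction n)
  case 0
  show ?case using rat_value_const[of 1 t] by (simp add: pCons_one)
qed (simp add: rat_value_mult)

lemmas rat_value_intros = rat_value_const rat_value_ident rat_value_add rat_value_mult
  rat_value_diff rat_value_divide rat_value_power

lemma finite_poles: "finite {t. \<nexists>v. rat_value r t v}"
proof -
  obtain p q where "r = Fract p q" "q \<noteq> 0" by (cases r) auto
  then have "{t. \<nexists>v. rat_value r t v} \<subseteq> {t. poly q t = 0}"
    unfolding rat_value_def by blast
  then show ?thesis using poly_roots_finite[OF \<open>q \<noteq> 0\<close>] finite_subset by blast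
qed

lemma rat_eq_0_if_infinitely_many_zeros:
  assumes "infinite {t. rat_value r t 0}"
  shows "r = 0"
proof -
  obtain p q where r: "r = Fract p q" "q \<noteq> 0" by (cases r) auto
  have "{t. rat_value r t 0} \<subseteq> {t. poly q t = 0} \<union> {t. poly p t = 0}"
  proof safe
    fix t assume *: "rat_value r t 0" "poly p t \<noteq> 0"
    then have "rat_value r t (poly p t / poly q t)" if "poly q t \<noteq> 0"
      using that r unfolding rat_value_def by blast
    then show "poly q t = 0" using rat_value_unique[OF *(1)] *(2) by force
  qed
  then have "p = 0"
    using assms poly_roots_finite[of p] poly_roots_finite[OF r(2)] finite_subset by blast
  then show ?thesis using r by (simp add: fract_collapse)
qed

lemma rat_eq_if_infinitely_many_values:
  assumes "infinite {t. \<exists>v. rat_value r t v \<and> rat_value s t v}"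
  shows "r = s"
proof -
  have "{t. \<exists>v. rat_value r t v \<and> rat_value s t v} \<subseteq> {t. rat_value (r - s) t 0}"
    using rat_value_diff by fastforce
  then have "r - s = 0"
    using assms rat_eq_0_if_infinitely_many_zeros infinite_super by blast
  then show ?thesis by simp
qed

text \<open>\<open>R\<close> is the element \<open>g(r1, r2)\<close> of \<open>K(t)\<close>.  It
  is described by its values alone, so that \<open>g\<close> itself never has to be read as a
  polynomial over \<open>K(t)\<close>.\<close>

lemma rat_substitution:
  fixes g :: "'a::field poly poly"
  obtains R where
    "\<And>t x y. rat_value r1 t x \<Longrightarrow> rat_value r2 t y \<Longrightarrow> rat_value R t (eval2 g (x, y))"
proof -
  have "\<exists>R. \<forall>t x y. rat_value r1 t x \<longrightarrow> rat_value r2 t y \<longrightarrow> rat_value R t (eval2 g (x, y))"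
  proof (induction g rule: bivariate_induct)
    case (const c)
    show ?case using rat_value_const[of c] by auto
  next
    case (add g h)
    then obtain R S where
      "\<forall>t x y. rat_value r1 t x \<longrightarrow> rat_value r2 t y \<longrightarrow> rat_value R t (eval2 g (x, y))"
      "\<forall>t x y. rat_value r1 t x \<longrightarrow> rat_value r2 t y \<longrightarrow> rat_value S t (eval2 h (x, y))" by blast
    then show ?case by (intro exI[of _ "R + S"]) (simp add: rat_value_add)
  next
    case (mult g h)
    then obtain R S where
      "\<forall>t x y. rat_value r1 t x \<longrightarrow> rat_value r2 t y \<longrightarrow> rat_value R t (eval2 g (x, y))"
      "\<forall>t x y. rat_value r1 t x \<longrightarrow> rat_value r2 t y \<longrightarrow> rat_value S t (eval2 h (x, y))" by blast
    then show ?case by (intro exI[of _ "R * S"]) (simp add: rat_value_mult)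
  qed auto
  then show ?thesis using that by blast
qed

definition rat_image :: "'a::field poly fract \<times> 'a poly fract \<Rightarrow> ('a \<times> 'a) set" where
  "rat_image \<phi> = {(x, y). \<exists>t. rat_value (fst \<phi>) t x \<and> rat_value (snd \<phi>) t y}"

lemma rat_image_iff: "(x, y) \<in> rat_image (r1, r2) \<longleftrightarrow> (\<exists>t. rat_value r1 t x \<and> rat_value r2 t y)"
  by (simp add: rat_image_def)

lemma cofinite_regular:
  "finite {t. \<not> (\<exists>x y. rat_value r1 t x \<and> rat_value r2 t y)}"
  by (rule finite_subset[OF _ finite_UnI[OF finite_poles[of r1] finite_poles[of r2]]]) auto

lemma infinite_if_cofinite:
  fixes Q :: "'a::field_char_0 \<Rightarrow> bool"
  assumes "finite {t. \<not> Q t}"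
  shows "infinite {t. Q t}"
proof
  assume "finite {t. Q t}"
  moreover have "{t. Q t} \<union> {t. \<not> Q t} = UNIV" by auto
  ultimately show False using assms infinite_UNIV_char_0 by (metis finite_Un)
qed

lemma vanishes_on_rat_image_if_infinite:
  assumes "infinite {t. \<exists>x y. rat_value r1 t x \<and> rat_value r2 t y \<and> eval2 g (x, y) = 0}"
  shows "vanishes_on g (rat_image (r1, r2))"
proof -
  obtain R where R: "\<And>t x y. rat_value r1 t x \<Longrightarrow> rat_value r2 t y \<Longrightarrow> rat_value R t (eval2 g (x, y))"
    by (rule rat_substitution[of r1 r2 g]) (rule that)
  have "{t. \<exists>x y. rat_value r1 t x \<and> rat_value r2 t y \<and> eval2 g (x, y) = 0} \<subseteq> {t. rat_value R t 0}"
    using R by fastforce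
  then have "R = 0" using assms rat_eq_0_if_infinitely_many_zeros infinite_super by blast
  then have "rat_value R t 0" for t using rat_value_const[of 0 t] by simp
  then have "eval2 g (x, y) = 0" if "rat_value r1 t x" "rat_value r2 t y" for t x y
    using R[OF that] rat_value_unique by blast
  then show ?thesis by (auto simp: vanishes_on_def rat_image_iff)
qed

lemma rat_image_subset_if_infinite_Int:
  assumes "infinite (zero_locus {g} \<inter> rat_image \<phi>)"
  shows "rat_image \<phi> \<subseteq> zero_locus {g}"
proof -
  obtain r1 r2 where \<phi>: "\<phi> = (r1, r2)" by (cases \<phi>)
  let ?I = "{t. \<exists>x y. rat_value r1 t x \<and> rat_value r2 t y \<and> eval2 g (x, y) = 0}"
  let ?v = "\<lambda>r t. THE v. rat_value r t v"
  have the: "?v r t = v" if "rat_value r t v" for r t and v :: 'a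
    using that rat_value_unique by (intro the_equality) blast+
  have "zero_locus {g} \<inter> rat_image \<phi> \<subseteq> (\<lambda>t. (?v r1 t, ?v r2 t)) ` ?I"
  proof safe
    fix x y assume "(x, y) \<in> zero_locus {g}" "(x, y) \<in> rat_image \<phi>"
    then obtain t where t: "rat_value r1 t x" "rat_value r2 t y" "eval2 g (x, y) = 0"
      by (auto simp: \<phi> rat_image_iff zero_locus_def)
    then have "(x, y) = (?v r1 t, ?v r2 t)" using the[OF t(1)] the[OF t(2)] by simp
    then show "(x, y) \<in> (\<lambda>t. (?v r1 t, ?v r2 t)) ` ?I" using t by blast
  qed
  then have "infinite ?I" using assms finite_subset by blast
  then show ?thesis using vanishes_on_rat_image_if_infinite by (simp add: \<phi> flip: vanishes_on_iff_subset)
qed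

text \<open>The vanishing ideal is the kernel of \<open>g \<mapsto> g(r1, r2)\<close>, and
  \<open>K(t)\<close> has no zero divisors; in terms of values, one factor vanishes at infinitely
  many parameters and hence at all.\<close>

lemma prime_vanishing_rat_image:
  fixes \<phi> :: "'a::field_char_0 poly fract \<times> 'a poly fract"
  shows "prime_vanishing (rat_image \<phi>)"
  unfolding prime_vanishing_def
proof (intro allI impI)
  fix g h assume gh: "vanishes_on (g * h) (rat_image \<phi>)"
  obtain r1 r2 where \<phi>: "\<phi> = (r1, r2)" by (cases \<phi>)
  define Z where "Z k = {t. \<exists>x y. rat_value r1 t x \<and> rat_value r2 t y \<and> eval2 k (x, y) = 0}" for k
  let ?P = "{t. \<not> (\<exists>x y. rat_value r1 t x \<and> rat_value r2 t y)}"
  have "UNIV \<subseteq> ?P \<union> (Z g \<union> Z h)"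
  proof
    fix t
    have "eval2 g (x, y) = 0 \<or> eval2 h (x, y) = 0" if "rat_value r1 t x" "rat_value r2 t y" for x y
    proof -
      have "(x, y) \<in> rat_image \<phi>" using that by (auto simp: \<phi> rat_image_iff)
      then have "eval2 (g * h) (x, y) = 0" using gh unfolding vanishes_on_def by blast
      then show ?thesis by simp
    qed
    then show "t \<in> ?P \<union> (Z g \<union> Z h)" unfolding Z_def by blast
  qed
  then have "infinite (Z g \<union> Z h)"
    using cofinite_regular[of r1 r2] infinite_UNIV_char_0 finite_subset by (metis finite_Un)
  then show "vanishes_on g (rat_image \<phi>) \<or> vanishes_on h (rat_image \<phi>)"
    using vanishes_on_rat_image_if_infinite unfolding Z_def \<phi> by blast
qed

lemma infinite_rat_image:
  fixes r1 r2 :: "'a::field_char_0 poly fract"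
  assumes "\<not> (rat_constant r1 \<and> rat_constant r2)"
  shows "infinite (rat_image (r1, r2))"
proof
  assume fin: "finite (rat_image (r1, r2))"
  let ?R = "{t. \<exists>x y. rat_value r1 t x \<and> rat_value r2 t y}"
  have "?R = (\<Union>P\<in>rat_image (r1, r2). {t. rat_value r1 t (fst P) \<and> rat_value r2 t (snd P)})"
    by (auto simp: rat_image_iff) (metis fst_conv snd_conv rat_image_iff)
  moreover have "- ?R = {t. \<not> (\<exists>x y. rat_value r1 t x \<and> rat_value r2 t y)}" by auto
  then have "infinite ?R"
    using cofinite_regular[of r1 r2] infinite_UNIV_char_0 by (metis finite_Un Un_UNIV_left Compl_partition)
  ultimately obtain P where inf: "infinite {t. rat_value r1 t (fst P) \<and> rat_value r2 t (snd P)}"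
    using fin by auto
  have "r = const_rat c" if "{t. rat_value r1 t (fst P) \<and> rat_value r2 t (snd P)} \<subseteq> {t. rat_value r t c}" for r c
  proof (rule rat_eq_if_infinitely_many_values)
    have "{t. rat_value r t c} \<subseteq> {t. \<exists>v. rat_value r t v \<and> rat_value (const_rat c) t v}"
      using rat_value_const by blast
    then show "infinite {t. \<exists>v. rat_value r t v \<and> rat_value (const_rat c) t v}"
      using inf that by (meson infinite_super)
  qed
  from this[of r1 "fst P"] this[of r2 "snd P"] show False
    using assms unfolding rat_constant_def by blast
qed

section \<open>Lines and circles as rational images\<close>

definition norm_poly :: "'a::comm_ring_1 \<Rightarrow> 'a \<Rightarrow> 'a poly poly" where
  "norm_poly a b = ([:[:0, 1:]:] - [:[:a:]:]) ^ 2 + ([:0, 1:] - [:[:b:]:]) ^ 2"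

definition line_poly :: "'a::comm_ring_1 \<Rightarrow> 'a \<Rightarrow> 'a \<Rightarrow> 'a \<Rightarrow> 'a poly poly" where
  "line_poly a b u v = [:[:u:]:] * ([:[:0, 1:]:] - [:[:a:]:]) + [:[:v:]:] * ([:0, 1:] - [:[:b:]:])"

lemma eval2_norm_poly [simp]: "eval2 (norm_poly a b) (x, y) = (x - a) ^ 2 + (y - b) ^ 2"
  unfolding norm_poly_def by (simp only: eval2_simps fst_conv snd_conv)

lemma eval2_line_poly [simp]: "eval2 (line_poly a b u v) (x, y) = u * (x - a) + v * (y - b)"
  unfolding line_poly_def by (simp only: eval2_simps fst_conv snd_conv)

lemma line_subset_rat_image:
  fixes a b u v :: "'a::field"
  assumes "(u, v) \<noteq> (0, 0)"
  obtains \<phi> where "{(x, y). u * (x - a) + v * (y - b) = 0} \<subseteq> rat_image \<phi>"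
proof -
  let ?s = "to_fract [:0, 1:] :: 'a poly fract"
  let ?\<phi> = "(const_rat a - const_rat v * ?s, const_rat b + const_rat u * ?s)"
  have "(x, y) \<in> rat_image ?\<phi>" if eq: "u * (x - a) + v * (y - b) = 0" for x y
  proof -
    define t where "t = (if u = 0 then - (x - a) / v else (y - b) / u)"
    have "x = a - v * t \<and> y = b + u * t"
    proof (cases "u = 0")
      case True
      then show ?thesis using eq assms by (simp add: t_def)
    next
      case False
      then have "x - a = - (v * t)" using eq by (simp add: t_def field_simps eq_neg_iff_add_eq_0)
      then have "x = a - v * t" by (simp add: algebra_simps)
      then show ?thesis using False by (simp add: t_def)
    qed
    moreover have "rat_value (const_rat a - const_rat v * ?s) t (a - v * t)"
      "rat_value (const_rat b + const_rat u * ?s) t (b + u * t)"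
      by (intro rat_value_intros)+
    ultimately show ?thesis by (auto simp: rat_image_iff)
  qed
  then show ?thesis by (intro that[of ?\<phi>]) auto
qed

text \<open>In the isotropic coordinates \<open>w = (x - a) + j (y - b)\<close> and
  \<open>w' = (x - a) - j (y - b)\<close> the circle is the hyperbola
  \<open>w w' = e\<close>, parametrized by \<open>w\<close>.\<close>

lemma circle_subset_rat_image:
  fixes a b e j :: "'a::field_char_0"
  assumes "j ^ 2 = -1" "e \<noteq> 0"
  obtains \<phi> where "{(x, y). (x - a) ^ 2 + (y - b) ^ 2 = e} \<subseteq> rat_image \<phi>"
proof -
  let ?s = "to_fract [:0, 1:] :: 'a poly fract"
  let ?x = "const_rat a + const_rat (1 / 2) * (?s + const_rat e / ?s)"
  let ?y = "const_rat b + const_rat (1 / (2 * j)) * (?s - const_rat e / ?s)"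
  have "(x, y) \<in> rat_image (?x, ?y)" if eq: "(x - a) ^ 2 + (y - b) ^ 2 = e" for x y
  proof -
    have j: "j \<noteq> 0" using assms(1) by auto
    define w w' where "w = (x - a) + j * (y - b)" and "w' = (x - a) - j * (y - b)"
    have "w * w' = (x - a) ^ 2 - j ^ 2 * (y - b) ^ 2"
      by (simp add: w_def w'_def power2_eq_square algebra_simps)
    then have ww: "w * w' = e" using eq assms(1) by simp
    then have w: "w \<noteq> 0" using assms(2) by auto
    then have "e / w = w'" using ww by (simp add: field_simps)
    moreover have "x = a + 1 / 2 * (w + w')" by (simp add: w_def w'_def field_simps)
    moreover have "y = b + 1 / (2 * j) * (w - w')" using j by (simp add: w_def w'_def field_simps)
    moreover have "rat_value ?x w (a + 1 / 2 * (w + e / w))"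
      "rat_value ?y w (b + 1 / (2 * j) * (w - e / w))"
      by (intro rat_value_intros w)+
    ultimately show ?thesis by (auto simp: rat_image_iff)
  qed
  then show ?thesis by (intro that[of "(?x, ?y)"]) auto
qed

text \<open>The equation of a curve, if it holds at infinitely many points of a line or circle,
  holds at every parameter of a parametrization.  So only one inclusion is needed to recognize the
  curve.\<close>

lemma infinite_curve_in_rational_set:
  assumes "infinite (zero_locus {f})" "zero_locus {f} \<subseteq> R" "R \<subseteq> rat_image \<phi>"
  shows "zero_locus {f} = R"
proof -
  have "zero_locus {f} \<inter> rat_image \<phi> = zero_locus {f}" using assms by auto
  then have "rat_image \<phi> \<subseteq> zero_locus {f}"
    using rat_image_subset_if_infinite_Int assms(1) by metis
  then show ?thesis using assms by auto
qed

section \<open>Conchoid points in pairs\<close>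

definition conchoid_points :: "'a::comm_ring_1 poly poly \<Rightarrow> 'a \<Rightarrow> 'a \<Rightarrow> 'a \<Rightarrow> ('a \<times> 'a) set" where
  "conchoid_points f a b d =
    {(y1 + \<mu> * (y1 - a), y2 + \<mu> * (y2 - b)) |y1 y2 \<mu>.
       eval2 f (y1, y2) = 0 \<and> \<mu> ^ 2 * ((y1 - a) ^ 2 + (y2 - b) ^ 2) = d ^ 2}"

lemma conchoid_eq_closure: "conchoid f (a, b) d = zariski_closure (conchoid_points f a b d)"
proof -
  have "{(x1, x2). \<exists>y1 y2 l. eval2 f (y1, y2) = 0 \<and> sqnorm (x1 - y1, x2 - y2) = d ^ 2 \<and>
        x1 = a + l * (y1 - a) \<and> x2 = b + l * (y2 - b)} = conchoid_points f a b d" (is "?L = ?R")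
  proof (intro equalityI subrelI)
    fix x1 x2 assume "(x1, x2) \<in> ?L"
    then obtain y1 y2 l where y: "eval2 f (y1, y2) = 0" "sqnorm (x1 - y1, x2 - y2) = d ^ 2"
      "x1 = a + l * (y1 - a)" "x2 = b + l * (y2 - b)" by auto
    have "x1 = y1 + (l - 1) * (y1 - a)" "x2 = y2 + (l - 1) * (y2 - b)"
      by (simp_all add: y algebra_simps)
    moreover have "(l - 1) ^ 2 * ((y1 - a) ^ 2 + (y2 - b) ^ 2) = sqnorm (x1 - y1, x2 - y2)"
      by (simp add: sqnorm_def y(3,4) power2_eq_square algebra_simps)
    then have "(l - 1) ^ 2 * ((y1 - a) ^ 2 + (y2 - b) ^ 2) = d ^ 2" using y(2) by simp
    ultimately show "(x1, x2) \<in> ?R" using y(1) unfolding conchoid_points_def by blast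
  next
    fix x1 x2 assume "(x1, x2) \<in> ?R"
    then obtain y1 y2 \<mu> where y: "eval2 f (y1, y2) = 0" "\<mu> ^ 2 * ((y1 - a) ^ 2 + (y2 - b) ^ 2) = d ^ 2"
      "x1 = y1 + \<mu> * (y1 - a)" "x2 = y2 + \<mu> * (y2 - b)" unfolding conchoid_points_def by blast
    have "x1 = a + (1 + \<mu>) * (y1 - a)" "x2 = b + (1 + \<mu>) * (y2 - b)"
      by (simp_all add: y algebra_simps)
    moreover have "sqnorm (x1 - y1, x2 - y2) = \<mu> ^ 2 * ((y1 - a) ^ 2 + (y2 - b) ^ 2)"
      by (simp add: sqnorm_def y(3,4) power_mult_distrib distrib_left)
    then have "sqnorm (x1 - y1, x2 - y2) = d ^ 2" using y(2) by simp
    ultimately show "(x1, x2) \<in> ?L" using y(1) by blast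
  qed
  then show ?thesis by (simp add: conchoid_def)
qed

text \<open>The two conchoid points on the line from \<open>A\<close> through \<open>y\<close>
  belong to the two roots of \<open>\<mu>\<^sup>2 N(y) = e\<close>.  Reducing
  \<open>g(y + \<mu>(y - A))\<close> modulo this quadratic equation for \<open>\<mu>\<close>
  gives \<open>U(y) + \<mu> V(y)\<close> up to a power of \<open>N\<close>.  Over a field in
  which \<open>2\<close>, \<open>e\<close> and \<open>N(y)\<close> are not zero, \<open>g\<close>
  then vanishes at both points exactly if \<open>U\<close> and \<open>V\<close> vanish at
  \<open>y\<close>.\<close>

lemma conjugate_split:
  fixes g :: "'a::comm_ring_1 poly poly"
  obtains m U V where
    "\<And>y1 y2 \<mu>. \<mu> ^ 2 * ((y1 - a) ^ 2 + (y2 - b) ^ 2) = e \<Longrightarrow>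
       ((y1 - a) ^ 2 + (y2 - b) ^ 2) ^ m * eval2 g (y1 + \<mu> * (y1 - a), y2 + \<mu> * (y2 - b)) =
       eval2 U (y1, y2) + \<mu> * eval2 V (y1, y2)"
proof -
  define N where "N y1 y2 = (y1 - a) ^ 2 + (y2 - b) ^ 2" for y1 y2
  define split where "split g m U V \<longleftrightarrow> (\<forall>y1 y2 \<mu>. \<mu> ^ 2 * N y1 y2 = e \<longrightarrow>
     N y1 y2 ^ m * eval2 g (y1 + \<mu> * (y1 - a), y2 + \<mu> * (y2 - b)) =
     eval2 U (y1, y2) + \<mu> * eval2 V (y1, y2))" for g m U V
  have N: "eval2 (norm_poly a b) (y1, y2) = N y1 y2" for y1 y2 by (simp add: N_def)
  have "\<exists>m U V. split g m U V"
  proof (induction g rule: bivariate_induct)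
    case (const c)
    have "split [:[:c:]:] 0 [:[:c:]:] 0" by (simp add: split_def)
    then show ?case by blast
  next
    case X
    have "split [:[:0, 1:]:] 0 [:[:0, 1:]:] ([:[:0, 1:]:] - [:[:a:]:])"
      unfolding split_def by (simp only: eval2_simps fst_conv snd_conv power_0 mult_1_left) simp
    then show ?case by blast
  next
    case Y
    have "split [:0, 1:] 0 [:0, 1:] ([:0, 1:] - [:[:b:]:])"
      unfolding split_def by (simp only: eval2_simps fst_conv snd_conv power_0 mult_1_left) simp
    then show ?case by blast
  next
    case (add g h)
    then obtain m U V m' U' V' where *: "split g m U V" "split h m' U' V'" by blast
    have "split (g + h) (m + m') (norm_poly a b ^ m' * U + norm_poly a b ^ m * U')
      (norm_poly a b ^ m' * V + norm_poly a b ^ m * V')"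
      unfolding split_def
    proof (intro allI impI)
      fix y1 y2 \<mu> assume \<mu>: "\<mu> ^ 2 * N y1 y2 = e"
      let ?g = "\<lambda>g. eval2 g (y1 + \<mu> * (y1 - a), y2 + \<mu> * (y2 - b))"
      have "N y1 y2 ^ (m + m') * ?g (g + h) =
        N y1 y2 ^ m' * (N y1 y2 ^ m * ?g g) + N y1 y2 ^ m * (N y1 y2 ^ m' * ?g h)"
        by (simp add: power_add algebra_simps)
      also have "\<dots> = N y1 y2 ^ m' * (eval2 U (y1, y2) + \<mu> * eval2 V (y1, y2))
        + N y1 y2 ^ m * (eval2 U' (y1, y2) + \<mu> * eval2 V' (y1, y2))"
        using * \<mu> unfolding split_def by presburger
      finally show "N y1 y2 ^ (m + m') * ?g (g + h) =
        eval2 (norm_poly a b ^ m' * U + norm_poly a b ^ m * U') (y1, y2) +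
        \<mu> * eval2 (norm_poly a b ^ m' * V + norm_poly a b ^ m * V') (y1, y2)"
        by (simp add: N algebra_simps del: eval2_norm_poly)
    qed
    then show ?case by blast
  next
    case (mult g h)
    then obtain m U V m' U' V' where *: "split g m U V" "split h m' U' V'" by blast
    let ?U = "norm_poly a b * U * U' + [:[:e:]:] * V * V'"
    let ?V = "norm_poly a b * (U * V' + U' * V)"
    have "split (g * h) (Suc (m + m')) ?U ?V"
      unfolding split_def
    proof (intro allI impI)
      fix y1 y2 \<mu> assume \<mu>: "\<mu> ^ 2 * N y1 y2 = e"
      let ?g = "\<lambda>g. eval2 g (y1 + \<mu> * (y1 - a), y2 + \<mu> * (y2 - b))"
      have "N y1 y2 ^ Suc (m + m') * ?g (g * h) =
        N y1 y2 * ((N y1 y2 ^ m * ?g g) * (N y1 y2 ^ m' * ?g h))"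
        by (simp add: power_add algebra_simps)
      also have "\<dots> = N y1 y2 * ((eval2 U (y1, y2) + \<mu> * eval2 V (y1, y2)) *
        (eval2 U' (y1, y2) + \<mu> * eval2 V' (y1, y2)))"
        using * \<mu> unfolding split_def by presburger
      also have "\<dots> = N y1 y2 * eval2 U (y1, y2) * eval2 U' (y1, y2)
          + (\<mu> ^ 2 * N y1 y2) * eval2 V (y1, y2) * eval2 V' (y1, y2)
          + \<mu> * (N y1 y2 * (eval2 U (y1, y2) * eval2 V' (y1, y2) + eval2 U' (y1, y2) * eval2 V (y1, y2)))"
        by (simp add: power2_eq_square algebra_simps)
      also have "\<dots> = eval2 ?U (y1, y2) + \<mu> * eval2 ?V (y1, y2)"
        unfolding \<mu> by (simp only: eval2_simps N)
      finally show "N y1 y2 ^ Suc (m + m') * ?g (g * h) = eval2 ?U (y1, y2) + \<mu> * eval2 ?V (y1, y2)" .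
    qed
    then show ?case by blast
  qed
  then show ?thesis using that unfolding split_def N_def by blast
qed

lemma sqrt_quotient_exists:
  fixes N d :: "'a::alg_closed_field"
  assumes "N \<noteq> 0"
  obtains \<mu> where "\<mu> ^ 2 * N = d ^ 2"
proof -
  obtain \<mu> where "\<mu> ^ 2 = d ^ 2 / N" using nth_root_exists[of 2 "d ^ 2 / N"] by auto
  then show ?thesis using that[of \<mu>] assms by simp
qed

section \<open>The conchoid of a rational curve\<close>

text \<open>\<open>n\<close> is \<open>N\<close> pulled back to the parameter line; whether it is a
  square in \<open>K(t)\<close> decides whether the two conchoid points over a parameter can be
  separated rationally.\<close>

locale rational_curve_with_focus =
  fixes f :: "'a::{alg_closed_field, field_char_0} poly poly" and a b d :: 'a
    and r1 r2 :: "'a poly fract"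
  assumes d: "d \<noteq> 0" and irreducible: "irreducible f"
    and dense: "zariski_closure (rat_image (r1, r2)) = zero_locus {f}"
    and nonconstant: "\<not> (rat_constant r1 \<and> rat_constant r2)"
    and not_circle: "zero_locus {f} \<noteq> {(y1, y2). (y1 - a) ^ 2 + (y2 - b) ^ 2 = d ^ 2}"
    and not_line: "\<And>u v. (u, v) \<noteq> (0, 0) \<Longrightarrow>
      zero_locus {f} \<noteq> {(y1, y2). u * (y1 - a) + v * (y2 - b) = 0}"
begin

abbreviation "N y1 y2 \<equiv> (y1 - a) ^ 2 + (y2 - b) ^ 2"
abbreviation "n \<equiv> (r1 - const_rat a) ^ 2 + (r2 - const_rat b) ^ 2"
abbreviation "S \<equiv> conchoid_points f a b d"
abbreviation "at_param t y1 y2 \<equiv> rat_value r1 t y1 \<and> rat_value r2 t y2"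

lemma rat_value_n: "at_param t y1 y2 \<Longrightarrow> rat_value n t (N y1 y2)"
  by (intro rat_value_intros) auto

lemma vanishes_on_curve_iff: "vanishes_on g (zero_locus {f}) \<longleftrightarrow> vanishes_on g (rat_image (r1, r2))"
  by (simp flip: dense)

lemma vanishes_on_image_if_infinite:
  assumes "infinite {t. \<exists>y1 y2. at_param t y1 y2 \<and> eval2 g (y1, y2) = 0}"
  shows "vanishes_on g (rat_image (r1, r2))"
  using vanishes_on_rat_image_if_infinite[of r1 r2 g] assms by simp

lemma vanishes_on_curve_if_infinite:
  assumes "infinite {t. \<exists>y1 y2. at_param t y1 y2 \<and> eval2 g (y1, y2) = 0}"
  shows "vanishes_on g (zero_locus {f})"
  using vanishes_on_image_if_infinite[OF assms] by (simp add: vanishes_on_curve_iff)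

lemma infinite_curve: "infinite (zero_locus {f})"
  using infinite_rat_image[OF nonconstant] subset_zariski_closure[of "rat_image (r1, r2)"] dense
  by (metis infinite_super)

lemma not_in_line:
  assumes "(u, v) \<noteq> (0, 0)"
  shows "\<not> vanishes_on (line_poly a b u v) (zero_locus {f})"
proof
  assume "vanishes_on (line_poly a b u v) (zero_locus {f})"
  then have sub: "zero_locus {f} \<subseteq> {(y1, y2). u * (y1 - a) + v * (y2 - b) = 0}"
    by (auto simp: vanishes_on_def)
  obtain \<phi> where "{(y1, y2). u * (y1 - a) + v * (y2 - b) = 0} \<subseteq> rat_image \<phi>"
    by (rule line_subset_rat_image[OF assms]) (rule that)
  then show False using infinite_curve_in_rational_set[OF infinite_curve sub] not_line[OF assms] by blast
qed

lemma not_in_circle: "\<not> vanishes_on (norm_poly a b - [:[:d ^ 2:]:]) (zero_locus {f})"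
proof
  assume "vanishes_on (norm_poly a b - [:[:d ^ 2:]:]) (zero_locus {f})"
  then have sub: "zero_locus {f} \<subseteq> {(y1, y2). N y1 y2 = d ^ 2}"
    by (auto simp: vanishes_on_def)
  obtain j :: 'a where "j ^ 2 = -1" using nth_root_exists[of 2 "-1 :: 'a"] by auto
  moreover have "d ^ 2 \<noteq> 0" using d by simp
  ultimately obtain \<phi> where "{(y1, y2). N y1 y2 = d ^ 2} \<subseteq> rat_image \<phi>"
    by (rule circle_subset_rat_image) (rule that)
  then show False using infinite_curve_in_rational_set[OF infinite_curve sub] not_circle by blast
qed

text \<open>The isotropic cone \<open>N = 0\<close> is a pair of lines through the focus, and the
  curve lies on neither.\<close>

lemma finite_isotropic_params: "finite {t. \<not> (\<exists>y1 y2. at_param t y1 y2 \<and> N y1 y2 \<noteq> 0)}"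
proof (rule ccontr)
  let ?I = "{t. \<exists>y1 y2. at_param t y1 y2 \<and> eval2 (norm_poly a b) (y1, y2) = 0}"
  assume "\<not> ?thesis"
  moreover have "{t. \<not> (\<exists>y1 y2. at_param t y1 y2 \<and> N y1 y2 \<noteq> 0)} \<subseteq> ?I \<union> {t. \<not> (\<exists>y1 y2. at_param t y1 y2)}"
    by auto
  ultimately have "infinite ?I" using cofinite_regular[of r1 r2] by (meson finite_Un finite_subset)
  then have "vanishes_on (norm_poly a b) (rat_image (r1, r2))"
    by (rule vanishes_on_image_if_infinite)
  moreover obtain j :: 'a where j: "j ^ 2 = -1" using nth_root_exists[of 2 "-1 :: 'a"] by auto
  have "eval2 (norm_poly a b) (x, y) = eval2 (line_poly a b 1 j * line_poly a b 1 (- j)) (x, y)" for x y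
  proof -
    have "(x - a + j * (y - b)) * (x - a + - j * (y - b)) = (x - a) ^ 2 - j ^ 2 * (y - b) ^ 2"
      by (simp add: power2_eq_square algebra_simps)
    then show ?thesis using j by simp
  qed
  ultimately have "vanishes_on (line_poly a b 1 j * line_poly a b 1 (- j)) (rat_image (r1, r2))"
    by (auto simp: vanishes_on_def simp del: eval2_line_poly eval2_simps)
  then have "vanishes_on (line_poly a b 1 j) (rat_image (r1, r2)) \<or>
    vanishes_on (line_poly a b 1 (- j)) (rat_image (r1, r2))"
    using prime_vanishing_rat_image unfolding prime_vanishing_def by blast
  then show False using not_in_line[of 1 j] not_in_line[of 1 "- j"] by (simp add: vanishes_on_curve_iff)
qed

lemma infinite_anisotropic_params: "infinite {t. \<exists>y1 y2. at_param t y1 y2 \<and> N y1 y2 \<noteq> 0}"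
  by (rule infinite_if_cofinite[OF finite_isotropic_params])

lemma conchoid_point:
  assumes "at_param t y1 y2" "\<mu> ^ 2 * N y1 y2 = d ^ 2"
  shows "(y1 + \<mu> * (y1 - a), y2 + \<mu> * (y2 - b)) \<in> S"
proof -
  have "(y1, y2) \<in> rat_image (r1, r2)" using assms(1) by (auto simp: rat_image_iff)
  then have "(y1, y2) \<in> zero_locus {f}" using subset_zariski_closure dense by blast
  then have "eval2 f (y1, y2) = 0" by (simp add: zero_locus_def)
  then show ?thesis using assms(2) unfolding conchoid_points_def by blast
qed

text \<open>The parametrization may miss points of the curve, and it has to be shown that their
  conchoid points are still limits of the others.  Vanishing of \<open>g\<close> at both conchoid
  points of \<open>y\<close> is the polynomial condition \<open>U(y) = V(y) = 0\<close>, so it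
  extends from infinitely many parameters to the whole curve.\<close>

lemma vanishes_on_conchoid_if_infinite:
  assumes "infinite {t. \<exists>y1 y2. at_param t y1 y2 \<and> N y1 y2 \<noteq> 0 \<and>
    (\<forall>\<mu>. \<mu> ^ 2 * N y1 y2 = d ^ 2 \<longrightarrow> eval2 g (y1 + \<mu> * (y1 - a), y2 + \<mu> * (y2 - b)) = 0)}"
  shows "vanishes_on g S"
proof -
  obtain m U V where split: "\<And>y1 y2 \<mu>. \<mu> ^ 2 * N y1 y2 = d ^ 2 \<Longrightarrow>
       N y1 y2 ^ m * eval2 g (y1 + \<mu> * (y1 - a), y2 + \<mu> * (y2 - b)) =
       eval2 U (y1, y2) + \<mu> * eval2 V (y1, y2)"
    by (rule conjugate_split[of a b "d ^ 2" g]) (rule that)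
  have UV: "eval2 U (y1, y2) = 0 \<and> eval2 V (y1, y2) = 0"
    if N: "N y1 y2 \<noteq> 0" and van: "\<forall>\<mu>. \<mu> ^ 2 * N y1 y2 = d ^ 2 \<longrightarrow>
      eval2 g (y1 + \<mu> * (y1 - a), y2 + \<mu> * (y2 - b)) = 0" for y1 y2
  proof -
    obtain \<mu> where \<mu>: "\<mu> ^ 2 * N y1 y2 = d ^ 2" by (rule sqrt_quotient_exists[OF N])
    then have "(- \<mu>) ^ 2 * N y1 y2 = d ^ 2" by simp
    then have "eval2 U (y1, y2) + \<mu> * eval2 V (y1, y2) = 0"
      "eval2 U (y1, y2) + - \<mu> * eval2 V (y1, y2) = 0"
      using split[OF \<mu>] split[of "- \<mu>" y1 y2] van \<mu> by (metis mult_zero_right)+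
    then have "2 * eval2 U (y1, y2) = 0" "2 * (\<mu> * eval2 V (y1, y2)) = 0" by algebra+
    moreover have "\<mu> \<noteq> 0" using \<mu> d by auto
    ultimately show ?thesis by simp
  qed
  have "vanishes_on U (zero_locus {f})" "vanishes_on V (zero_locus {f})"
    by (rule vanishes_on_curve_if_infinite, rule infinite_super[OF _ assms], use UV in blast)+
  then have "eval2 U (y1, y2) = 0 \<and> eval2 V (y1, y2) = 0" if "eval2 f (y1, y2) = 0" for y1 y2
    using that by (simp add: vanishes_on_def zero_locus_def)
  then have "eval2 g (y1 + \<mu> * (y1 - a), y2 + \<mu> * (y2 - b)) = 0"
    if "eval2 f (y1, y2) = 0" "\<mu> ^ 2 * N y1 y2 = d ^ 2" for y1 y2 \<mu>
    using split[OF that(2)] that d by auto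
  then show ?thesis unfolding vanishes_on_def conchoid_points_def by blast
qed

text \<open>Otherwise \<open>Y - b\<close> divides the irreducible polynomial \<open>f\<close>,
  and the curve is the line \<open>y = b\<close> through the focus.\<close>

lemma horizontal_line_not_in_curve: "poly f [:b:] \<noteq> 0"
proof
  assume "poly f [:b:] = 0"
  then obtain q where q: "f = [:- [:b:], 1:] * q" using poly_eq_0_iff_dvd[of f "[:b:]"] by auto
  have "\<not> [:- [:b:], 1:] dvd (1 :: 'a poly poly)"
  proof
    assume "[:- [:b:], 1:] dvd (1 :: 'a poly poly)"
    then obtain s where "(1 :: 'a poly poly) = [:- [:b:], 1:] * s" by (elim dvdE)
    then have "eval2 1 (0, b) = eval2 ([:- [:b:], 1:] * s) (0, b)" by (rule arg_cong)
    then show False by (simp add: eval2_def)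
  qed
  then have "q dvd 1" using irreducible q irreducibleD by blast
  then obtain q' where "1 = q * q'" by auto
  then have "eval2 q P \<noteq> 0" for P by (metis eval2_simps(2,8) mult_zero_left zero_neq_one)
  moreover have "eval2 f (x, y) = (y - b) * eval2 q (x, y)" for x y
    by (simp add: q eval2_def algebra_simps)
  ultimately have "zero_locus {f} = {(x, y). 0 * (x - a) + 1 * (y - b) = 0}"
    by (auto simp: zero_locus_def)
  then show False using not_line[of 0 1] by simp
qed

text \<open>A conchoid point \<open>x\<close> lies at distance \<open>d\<close> from a point of the
  curve on the line joining it to the focus.  Splitting \<open>f\<close> at \<open>x\<close> and
  taking \<open>N(x)\<close> times the norm of \<open>U + \<kappa> V\<close>, which is
  \<open>N U\<^sup>2 - d\<^sup>2 V\<^sup>2\<close> since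
  \<open>\<kappa>\<^sup>2 N = d\<^sup>2\<close>, turns this into a polynomial equation for
  \<open>x\<close>.  It is not trivial, because it fails at almost all points of the horizontal
  line through the focus.\<close>

lemma conchoid_equation: "\<exists>g. g \<noteq> 0 \<and> vanishes_on g S"
proof -
  obtain m U V where split: "\<And>y1 y2 \<mu>. \<mu> ^ 2 * N y1 y2 = d ^ 2 \<Longrightarrow>
       N y1 y2 ^ m * eval2 f (y1 + \<mu> * (y1 - a), y2 + \<mu> * (y2 - b)) =
       eval2 U (y1, y2) + \<mu> * eval2 V (y1, y2)"
    by (rule conjugate_split[of a b "d ^ 2" f]) (rule that)
  define G where "G = norm_poly a b * (norm_poly a b * U ^ 2 - [:[:d ^ 2:]:] * V ^ 2)"
  have G: "eval2 G (x1, x2) = N x1 x2 ^ 2 *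
      ((eval2 U (x1, x2) + \<kappa> * eval2 V (x1, x2)) * (eval2 U (x1, x2) + - \<kappa> * eval2 V (x1, x2)))"
    if \<kappa>: "\<kappa> ^ 2 * N x1 x2 = d ^ 2" for x1 x2 \<kappa>
    unfolding G_def by (simp add: \<kappa>[symmetric]) algebra
  \<comment> \<open>With \<open>x - A = (1 + \<mu>)(y - A)\<close>, the way back to \<open>y = x + \<kappa>(x - A)\<close> requires
     \<open>(1 + \<kappa>)(1 + \<mu>) = 1\<close>.  If \<open>1 + \<mu> = 0\<close> then \<open>x\<close> is the focus, a zero of the outer
     factor of \<open>G\<close>.\<close>
  have "eval2 G (x1, x2) = 0" if x: "(x1, x2) \<in> S" for x1 x2
  proof -
    obtain y1 y2 \<mu> where y: "eval2 f (y1, y2) = 0" "\<mu> ^ 2 * N y1 y2 = d ^ 2"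
      "x1 = y1 + \<mu> * (y1 - a)" "x2 = y2 + \<mu> * (y2 - b)"
      using x unfolding conchoid_points_def by blast
    have M: "N x1 x2 = (1 + \<mu>) ^ 2 * N y1 y2" unfolding y(3,4) by algebra
    show ?thesis
    proof (cases "1 + \<mu> = 0")
      case True
      then show ?thesis using M by (simp add: G_def)
    next
      case False
      define \<kappa> where "\<kappa> = - \<mu> / (1 + \<mu>)"
      have \<kappa>': "\<kappa> * (1 + \<mu>) = - \<mu>" using False by (simp add: \<kappa>_def)
      have "\<kappa> ^ 2 * N x1 x2 = (\<kappa> * (1 + \<mu>)) ^ 2 * N y1 y2"
        unfolding M by (simp add: power_mult_distrib mult_ac)
      then have \<kappa>: "\<kappa> ^ 2 * N x1 x2 = d ^ 2" using y(2) \<kappa>' by simp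
      have "x1 + \<kappa> * (x1 - a) = y1" "x2 + \<kappa> * (x2 - b) = y2"
        unfolding y(3,4) using \<kappa>' by algebra+
      then have "eval2 U (x1, x2) + \<kappa> * eval2 V (x1, x2) = 0"
        using split[OF \<kappa>] y(1) by simp
      then show ?thesis using G[OF \<kappa>] by simp
    qed
  qed
  then have "vanishes_on G S" by (auto simp: vanishes_on_def)
  moreover have "G \<noteq> 0"
  proof -
    \<comment> \<open>At \<open>(a + s, b)\<close> the roots are \<open>\<kappa> = d / s\<close> and \<open>- d / s\<close>, so the two points to be kept off the
       curve are \<open>(a + s + d, b)\<close> and \<open>(a + s - d, b)\<close>.\<close>
    let ?Z = "{x. poly (poly f [:b:]) x = 0}"
    have "finite (insert 0 ((\<lambda>x. x - a - d) ` ?Z \<union> (\<lambda>x. x - a + d) ` ?Z))"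
      using poly_roots_finite[OF horizontal_line_not_in_curve] by simp
    then obtain s where "s \<notin> insert 0 ((\<lambda>x. x - a - d) ` ?Z \<union> (\<lambda>x. x - a + d) ` ?Z)"
      using ex_new_if_finite infinite_UNIV_char_0 by blast
    then have s: "s \<noteq> 0" "a + s + d \<notin> ?Z" "a + s - d \<notin> ?Z" by (force simp: image_iff)+
    have f: "eval2 f (a + s + d, b) \<noteq> 0" "eval2 f (a + s - d, b) \<noteq> 0"
      using s by (auto simp: eval2_def)
    have \<kappa>: "(d / s) ^ 2 * N (a + s) b = d ^ 2" "(- (d / s)) ^ 2 * N (a + s) b = d ^ 2"
      using s by (simp_all add: field_simps)
    have "eval2 U (a + s, b) + d / s * eval2 V (a + s, b) \<noteq> 0"
      "eval2 U (a + s, b) + - (d / s) * eval2 V (a + s, b) \<noteq> 0"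
      unfolding split[OF \<kappa>(1), symmetric] split[OF \<kappa>(2), symmetric] using f s by simp_all
    then have "eval2 G (a + s, b) \<noteq> 0" unfolding G[OF \<kappa>(1)] using s by simp
    then show ?thesis by auto
  qed
  ultimately show ?thesis by blast
qed

text \<open>A conchoid point is collinear with the focus and the point \<open>y\<close> it comes
  from.  If it is not the focus, infinitely many parameters put the curve on the line through
  both.  If it is the focus, then \<open>\<mu> = -1\<close> and
  \<open>N(y) = d\<^sup>2\<close>, so they put the curve on the circle.\<close>

lemma finite_fibre:
  "finite {t. \<exists>y1 y2 \<mu>. at_param t y1 y2 \<and> \<mu> ^ 2 * N y1 y2 = d ^ 2 \<and>
     (x1, x2) = (y1 + \<mu> * (y1 - a), y2 + \<mu> * (y2 - b))}" (is "finite ?I")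
proof (rule ccontr)
  assume inf: "infinite ?I"
  show False
  proof (cases "(x1, x2) = (a, b)")
    case False
    have "(x2 - b) * (y1 - a) + - (x1 - a) * (y2 - b) = 0"
      if "(x1, x2) = (y1 + \<mu> * (y1 - a), y2 + \<mu> * (y2 - b))" for y1 y2 \<mu>
    proof -
      have x: "x1 = y1 + \<mu> * (y1 - a)" "x2 = y2 + \<mu> * (y2 - b)" using that by auto
      show ?thesis unfolding x by (simp add: algebra_simps)
    qed
    then have "?I \<subseteq> {t. \<exists>y1 y2. at_param t y1 y2 \<and>
      eval2 (line_poly a b (x2 - b) (- (x1 - a))) (y1, y2) = 0}" by fastforce
    then have "vanishes_on (line_poly a b (x2 - b) (- (x1 - a))) (zero_locus {f})"
      using vanishes_on_curve_if_infinite inf infinite_super by blast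
    then show False using not_in_line[of "x2 - b" "- (x1 - a)"] False by auto
  next
    case True
    have "N y1 y2 = d ^ 2"
      if "\<mu> ^ 2 * N y1 y2 = d ^ 2" "(x1, x2) = (y1 + \<mu> * (y1 - a), y2 + \<mu> * (y2 - b))" for y1 y2 \<mu>
    proof -
      have "(1 + \<mu>) * (y1 - a) = (y1 + \<mu> * (y1 - a)) - a" "(1 + \<mu>) * (y2 - b) = (y2 + \<mu> * (y2 - b)) - b"
        by (simp_all add: algebra_simps)
      then have "(1 + \<mu>) * (y1 - a) = 0" "(1 + \<mu>) * (y2 - b) = 0" using that(2) True by auto
      moreover have "N y1 y2 \<noteq> 0" using that(1) d by auto
      ultimately have "\<mu> = -1" by (auto simp: add_eq_0_iff)
      then show ?thesis using that(1) by simp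
    qed
    then have "?I \<subseteq> {t. \<exists>y1 y2. at_param t y1 y2 \<and>
      eval2 (norm_poly a b - [:[:d ^ 2:]:]) (y1, y2) = 0}" by fastforce
    then show False
      using vanishes_on_curve_if_infinite inf infinite_super not_in_circle by blast
  qed
qed

text \<open>Here \<open>\<mu> = d / \<surd>n\<close> generates a quadratic field extension of
  \<open>K(t)\<close>, and \<open>n U\<^sup>2 - d\<^sup>2 V\<^sup>2\<close> is \<open>n\<close>
  times the norm of \<open>U + \<mu>V\<close>.\<close>

lemma norm_zero_imp_zero:
  assumes nonsquare: "\<And>m. n \<noteq> m ^ 2"
    and van: "vanishes_on (norm_poly a b * U ^ 2 - [:[:d ^ 2:]:] * V ^ 2) (rat_image (r1, r2))"
    and at: "at_param t y1 y2"
  shows "eval2 U (y1, y2) = 0 \<and> eval2 V (y1, y2) = 0"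
proof -
  obtain u where u: "\<And>t x y. rat_value r1 t x \<Longrightarrow> rat_value r2 t y \<Longrightarrow> rat_value u t (eval2 U (x, y))"
    by (rule rat_substitution[of r1 r2 U]) (rule that)
  obtain v where v: "\<And>t x y. rat_value r1 t x \<Longrightarrow> rat_value r2 t y \<Longrightarrow> rat_value v t (eval2 V (x, y))"
    by (rule rat_substitution[of r1 r2 V]) (rule that)
  have "n * u ^ 2 - const_rat (d ^ 2) * v ^ 2 = 0"
  proof (rule rat_eq_0_if_infinitely_many_zeros)
    have "rat_value (n * u ^ 2 - const_rat (d ^ 2) * v ^ 2) t 0" if "at_param t y1 y2" for t y1 y2
    proof -
      have "rat_value (n * u ^ 2 - const_rat (d ^ 2) * v ^ 2) t
        (N y1 y2 * eval2 U (y1, y2) ^ 2 - d ^ 2 * eval2 V (y1, y2) ^ 2)"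
        using that by (intro rat_value_diff rat_value_mult rat_value_power rat_value_const rat_value_n u v) auto
      moreover have "eval2 (norm_poly a b * U ^ 2 - [:[:d ^ 2:]:] * V ^ 2) (y1, y2) = 0"
        using van that unfolding vanishes_on_def by (auto simp: rat_image_def)
      ultimately show ?thesis by simp
    qed
    then have "{t. \<exists>y1 y2. at_param t y1 y2} \<subseteq>
      {t. rat_value (n * u ^ 2 - const_rat (d ^ 2) * v ^ 2) t 0}" by blast
    then show "infinite {t. rat_value (n * u ^ 2 - const_rat (d ^ 2) * v ^ 2) t 0}"
      using infinite_if_cofinite[OF cofinite_regular[of r1 r2]] infinite_super by blast
  qed
  then have eq: "n * u ^ 2 = (const_rat d * v) ^ 2"
    by (simp add: power_mult_distrib power2_eq_square flip: to_fract_mult)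
  have "u = 0"
  proof (rule ccontr)
    assume "u \<noteq> 0"
    then have "n = (const_rat d * v / u) ^ 2" using eq by (simp add: power_divide field_simps)
    then show False using nonsquare by blast
  qed
  moreover have "const_rat d \<noteq> 0" using d by simp
  ultimately have "u = const_rat 0" "v = const_rat 0" using eq by auto
  then show ?thesis
    using u[of t y1 y2] v[of t y1 y2] at rat_value_const[of 0 t] rat_value_unique by metis
qed

lemma vanishes_on_conchoid_if_norm_vanishes:
  assumes nonsquare: "\<And>m. n \<noteq> m ^ 2"
    and split: "\<And>y1 y2 \<mu>. \<mu> ^ 2 * N y1 y2 = d ^ 2 \<Longrightarrow>
       N y1 y2 ^ m * eval2 g (y1 + \<mu> * (y1 - a), y2 + \<mu> * (y2 - b)) =
       eval2 U (y1, y2) + \<mu> * eval2 V (y1, y2)"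
    and van: "vanishes_on (norm_poly a b * U ^ 2 - [:[:d ^ 2:]:] * V ^ 2) (rat_image (r1, r2))"
  shows "vanishes_on g S"
proof (rule vanishes_on_conchoid_if_infinite, rule infinite_super[OF _ infinite_anisotropic_params], safe)
  fix t y1 y2 assume t: "rat_value r1 t y1" "rat_value r2 t y2" and N: "N y1 y2 \<noteq> 0"
  then have UV: "eval2 U (y1, y2) = 0 \<and> eval2 V (y1, y2) = 0"
    using norm_zero_imp_zero[OF nonsquare van] by blast
  have "eval2 g (y1 + \<mu> * (y1 - a), y2 + \<mu> * (y2 - b)) = 0" if "\<mu> ^ 2 * N y1 y2 = d ^ 2" for \<mu>
    using split[OF that] UV N by simp
  then show "\<exists>y1 y2. at_param t y1 y2 \<and> N y1 y2 \<noteq> 0 \<and> (\<forall>\<mu>. \<mu> ^ 2 * N y1 y2 = d ^ 2 \<longrightarrow>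
    eval2 g (y1 + \<mu> * (y1 - a), y2 + \<mu> * (y2 - b)) = 0)" using t N by blast
qed

text \<open>Almost all conchoid points lie in the image of the irreducible double cover
  \<open>\<mu>\<^sup>2 n(t) = d\<^sup>2\<close> of the parameter line.  If a product vanishes on
  them, then so does the product of the norms of its factors, which is a function on the curve; and
  a factor with norm zero vanishes.\<close>

lemma prime_vanishing_conchoid_points:
  assumes nonsquare: "\<And>m. n \<noteq> m ^ 2"
  shows "prime_vanishing S"
  unfolding prime_vanishing_def
proof (intro allI impI)
  fix g h assume gh: "vanishes_on (g * h) S"
  obtain m U V where split: "\<And>y1 y2 \<mu>. \<mu> ^ 2 * N y1 y2 = d ^ 2 \<Longrightarrow>
       N y1 y2 ^ m * eval2 g (y1 + \<mu> * (y1 - a), y2 + \<mu> * (y2 - b)) =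
       eval2 U (y1, y2) + \<mu> * eval2 V (y1, y2)"
    by (rule conjugate_split[of a b "d ^ 2" g]) (rule that)
  obtain m' U' V' where split': "\<And>y1 y2 \<mu>. \<mu> ^ 2 * N y1 y2 = d ^ 2 \<Longrightarrow>
       N y1 y2 ^ m' * eval2 h (y1 + \<mu> * (y1 - a), y2 + \<mu> * (y2 - b)) =
       eval2 U' (y1, y2) + \<mu> * eval2 V' (y1, y2)"
    by (rule conjugate_split[of a b "d ^ 2" h]) (rule that)
  define W where "W = norm_poly a b * U ^ 2 - [:[:d ^ 2:]:] * V ^ 2"
  define W' where "W' = norm_poly a b * U' ^ 2 - [:[:d ^ 2:]:] * V' ^ 2"
  have WW': "eval2 (W * W') (y1, y2) = 0" if at: "at_param t y1 y2" and N: "N y1 y2 \<noteq> 0" for t y1 y2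
  proof -
    have prod: "(eval2 U (y1, y2) + \<mu> * eval2 V (y1, y2)) * (eval2 U' (y1, y2) + \<mu> * eval2 V' (y1, y2)) = 0"
      if \<mu>: "\<mu> ^ 2 * N y1 y2 = d ^ 2" for \<mu>
    proof -
      have "eval2 (g * h) (y1 + \<mu> * (y1 - a), y2 + \<mu> * (y2 - b)) = 0"
        using conchoid_point[OF at \<mu>] gh unfolding vanishes_on_def by blast
      then show ?thesis unfolding split[OF \<mu>, symmetric] split'[OF \<mu>, symmetric] by auto
    qed
    obtain \<mu> where \<mu>: "\<mu> ^ 2 * N y1 y2 = d ^ 2" by (rule sqrt_quotient_exists[OF N])
    then have "(- \<mu>) ^ 2 * N y1 y2 = d ^ 2" by simp
    note p = prod[OF \<mu>] prod[OF this]
    have "eval2 (W * W') (y1, y2) = N y1 y2 ^ 2 *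
      (((eval2 U (y1, y2) + \<mu> * eval2 V (y1, y2)) * (eval2 U' (y1, y2) + \<mu> * eval2 V' (y1, y2))) *
      ((eval2 U (y1, y2) + - \<mu> * eval2 V (y1, y2)) * (eval2 U' (y1, y2) + - \<mu> * eval2 V' (y1, y2))))"
      unfolding W_def W'_def by (simp add: \<mu>[symmetric]) algebra
    then show ?thesis unfolding p by simp
  qed
  have "{t. \<exists>y1 y2. at_param t y1 y2 \<and> N y1 y2 \<noteq> 0} \<subseteq>
    {t. \<exists>y1 y2. at_param t y1 y2 \<and> eval2 (W * W') (y1, y2) = 0}" using WW' by blast
  then have "infinite {t. \<exists>y1 y2. at_param t y1 y2 \<and> eval2 (W * W') (y1, y2) = 0}"
    using infinite_anisotropic_params infinite_super by blast
  then have "vanishes_on (W * W') (rat_image (r1, r2))" by (rule vanishes_on_image_if_infinite)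
  then have "vanishes_on W (rat_image (r1, r2)) \<or> vanishes_on W' (rat_image (r1, r2))"
    using prime_vanishing_rat_image unfolding prime_vanishing_def by blast
  then show "vanishes_on g S \<or> vanishes_on h S"
    using vanishes_on_conchoid_if_norm_vanishes[OF nonsquare split]
      vanishes_on_conchoid_if_norm_vanishes[OF nonsquare split'] unfolding W_def W'_def by blast
qed

lemma infinite_conchoid_points: "infinite S"
proof
  assume fin: "finite S"
  let ?F = "\<lambda>P. {t. \<exists>y1 y2 \<mu>. at_param t y1 y2 \<and> \<mu> ^ 2 * N y1 y2 = d ^ 2 \<and>
     (fst P, snd P) = (y1 + \<mu> * (y1 - a), y2 + \<mu> * (y2 - b))}"
  have "t \<in> (\<Union>P\<in>S. ?F P)" if t: "at_param t y1 y2" and N: "N y1 y2 \<noteq> 0" for t y1 y2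
  proof -
    obtain \<mu> where \<mu>: "\<mu> ^ 2 * N y1 y2 = d ^ 2" by (rule sqrt_quotient_exists[OF N])
    let ?P = "(y1 + \<mu> * (y1 - a), y2 + \<mu> * (y2 - b))"
    have "?P \<in> S" by (rule conchoid_point[OF t \<mu>])
    moreover have "t \<in> ?F ?P" using t \<mu> by auto
    ultimately show ?thesis by blast
  qed
  then have "{t. \<exists>y1 y2. at_param t y1 y2 \<and> N y1 y2 \<noteq> 0} \<subseteq> (\<Union>P\<in>S. ?F P)" by blast
  moreover have "finite (\<Union>P\<in>S. ?F P)" using fin finite_fibre by (intro finite_UN_I)
  ultimately show False
    using infinite_anisotropic_params finite_subset by blast
qed

text \<open>For \<open>\<rho>\<^sup>2 n = d\<^sup>2\<close> in \<open>K(t)\<close> the conchoid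
  points with \<open>\<mu> = \<rho>(t)\<close>; the other choice of sign is
  \<open>branch (- \<rho>)\<close>.\<close>

definition branch :: "'a poly fract \<Rightarrow> 'a poly fract \<times> 'a poly fract" where
  "branch \<rho> = (r1 + \<rho> * (r1 - const_rat a), r2 + \<rho> * (r2 - const_rat b))"

lemma branch_value:
  assumes "at_param t y1 y2" "rat_value \<rho> t \<mu>"
  shows "rat_value (fst (branch \<rho>)) t (y1 + \<mu> * (y1 - a))"
    "rat_value (snd (branch \<rho>)) t (y2 + \<mu> * (y2 - b))"
  unfolding branch_def fst_conv snd_conv by (intro rat_value_intros assms conjunct1[OF assms(1)] conjunct2[OF assms(1)])+

lemma root_value:
  assumes "\<rho> ^ 2 * n = const_rat (d ^ 2)" "at_param t y1 y2" "rat_value \<rho> t \<mu>"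
  shows "\<mu> ^ 2 * N y1 y2 = d ^ 2"
proof (rule rat_value_unique)
  show "rat_value (\<rho> ^ 2 * n) t (\<mu> ^ 2 * N y1 y2)"
    by (rule rat_value_mult[OF rat_value_power[OF assms(3)] rat_value_n[OF assms(2)]])
  show "rat_value (\<rho> ^ 2 * n) t (d ^ 2)" unfolding assms(1) by (rule rat_value_const)
qed

lemma infinite_branch_params:
  "infinite {t. \<exists>y1 y2 \<mu>. at_param t y1 y2 \<and> N y1 y2 \<noteq> 0 \<and> rat_value \<rho> t \<mu>}" (is "infinite ?G")
proof -
  have "{t. \<exists>y1 y2. at_param t y1 y2 \<and> N y1 y2 \<noteq> 0} - {t. \<nexists>v. rat_value \<rho> t v} \<subseteq> ?G" by blast
  then show ?thesis
    using Diff_infinite_finite[OF finite_poles infinite_anisotropic_params] infinite_super by blast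
qed

lemma branch_nonconstant:
  assumes "\<rho> ^ 2 * n = const_rat (d ^ 2)"
  shows "\<not> (rat_constant (fst (branch \<rho>)) \<and> rat_constant (snd (branch \<rho>)))"
proof
  assume "rat_constant (fst (branch \<rho>)) \<and> rat_constant (snd (branch \<rho>))"
  then obtain x1 x2 where x: "fst (branch \<rho>) = const_rat x1" "snd (branch \<rho>) = const_rat x2"
    by (auto simp: rat_constant_def)
  have "(x1, x2) = (y1 + \<mu> * (y1 - a), y2 + \<mu> * (y2 - b))"
    if "at_param t y1 y2" "rat_value \<rho> t \<mu>" for t y1 y2 \<mu>
    using branch_value[OF that] rat_value_const rat_value_unique unfolding x by blast
  then have "{t. \<exists>y1 y2 \<mu>. at_param t y1 y2 \<and> N y1 y2 \<noteq> 0 \<and> rat_value \<rho> t \<mu>} \<subseteq>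
    {t. \<exists>y1 y2 \<mu>. at_param t y1 y2 \<and> \<mu> ^ 2 * N y1 y2 = d ^ 2 \<and>
      (x1, x2) = (y1 + \<mu> * (y1 - a), y2 + \<mu> * (y2 - b))}"
    using root_value[OF assms] by blast
  then show False using infinite_branch_params finite_fibre finite_subset by blast
qed

lemma vanishes_on_branch:
  assumes "\<rho> ^ 2 * n = const_rat (d ^ 2)" and g: "vanishes_on g S"
  shows "vanishes_on g (rat_image (branch \<rho>))"
proof -
  have "infinite {t. \<exists>x y. rat_value (fst (branch \<rho>)) t x \<and> rat_value (snd (branch \<rho>)) t y \<and> eval2 g (x, y) = 0}"
    (is "infinite ?I")
  proof (rule infinite_super[OF _ infinite_branch_params[of \<rho>]], safe)
    fix t y1 y2 \<mu> assume t: "rat_value r1 t y1" "rat_value r2 t y2" and \<mu>: "rat_value \<rho> t \<mu>"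
    then have at: "at_param t y1 y2" by simp
    have "eval2 g (y1 + \<mu> * (y1 - a), y2 + \<mu> * (y2 - b)) = 0"
      using conchoid_point[OF at root_value[OF assms(1) at \<mu>]] g unfolding vanishes_on_def by blast
    then show "\<exists>x y. rat_value (fst (branch \<rho>)) t x \<and> rat_value (snd (branch \<rho>)) t y \<and> eval2 g (x, y) = 0"
      using branch_value[OF at \<mu>] by blast
  qed
  then show ?thesis using vanishes_on_rat_image_if_infinite[of "fst (branch \<rho>)" "snd (branch \<rho>)"] by simp
qed

lemma vanishes_on_conchoid_iff_branches:
  assumes \<rho>: "\<rho> ^ 2 * n = const_rat (d ^ 2)"
  shows "vanishes_on g S \<longleftrightarrow> vanishes_on g (rat_image (branch \<rho>) \<union> rat_image (branch (- \<rho>)))"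
proof
  have "(- \<rho>) ^ 2 * n = const_rat (d ^ 2)" using \<rho> by simp
  then show "vanishes_on g S \<Longrightarrow> vanishes_on g (rat_image (branch \<rho>) \<union> rat_image (branch (- \<rho>)))"
    using vanishes_on_branch[OF \<rho>, of g] vanishes_on_branch[of "- \<rho>" g] by (auto simp: vanishes_on_def)
next
  assume g: "vanishes_on g (rat_image (branch \<rho>) \<union> rat_image (branch (- \<rho>)))"
  show "vanishes_on g S"
  proof (rule vanishes_on_conchoid_if_infinite, rule infinite_super[OF _ infinite_branch_params[of \<rho>]], safe)
    fix t y1 y2 \<mu> assume t: "rat_value r1 t y1" "rat_value r2 t y2" and N: "N y1 y2 \<noteq> 0"
      and \<mu>: "rat_value \<rho> t \<mu>"
    then have at: "at_param t y1 y2" by simp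
    have neg: "rat_value (- \<rho>) t (- \<mu>)"
      using rat_value_diff[OF rat_value_const[of 0] \<mu>] by simp
    have "eval2 g (y1 + \<mu>' * (y1 - a), y2 + \<mu>' * (y2 - b)) = 0" if "\<mu>' ^ 2 * N y1 y2 = d ^ 2" for \<mu>'
    proof -
      have "\<mu>' ^ 2 * N y1 y2 = \<mu> ^ 2 * N y1 y2" using root_value[OF \<rho> at \<mu>] that by simp
      then have "\<mu>' ^ 2 = \<mu> ^ 2" using N by simp
      then have "\<mu>' = \<mu> \<or> \<mu>' = - \<mu>" by (rule power2_eq_iff[THEN iffD1])
      then have "(y1 + \<mu>' * (y1 - a), y2 + \<mu>' * (y2 - b)) \<in> rat_image (branch \<rho>) \<union> rat_image (branch (- \<rho>))"
        using branch_value[OF at \<mu>] branch_value[OF at neg] by (auto simp: rat_image_def)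
      then show ?thesis using g unfolding vanishes_on_def by blast
    qed
    then show "\<exists>y1 y2. at_param t y1 y2 \<and> N y1 y2 \<noteq> 0 \<and> (\<forall>\<mu>. \<mu> ^ 2 * N y1 y2 = d ^ 2 \<longrightarrow>
      eval2 g (y1 + \<mu> * (y1 - a), y2 + \<mu> * (y2 - b)) = 0)" using at N by blast
  qed
qed

text \<open>Both branches are irreducible curves, so they coincide or neither contains the
  other.\<close>

lemma conchoid_split_case:
  assumes \<rho>: "\<rho> ^ 2 * n = const_rat (d ^ 2)"
  defines "D \<equiv> zariski_closure S"
  shows "plane_curve D" and "rational_curve D \<or>
    (\<not> zariski_irreducible D \<and> card (irreducible_components D) = 2 \<and>
        (\<forall>Z \<in> irreducible_components D. rational_curve Z))"
proof -
  define R where "R \<rho> = zariski_closure (rat_image (branch \<rho>))" for \<rho>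
  obtain g0 where g0: "g0 \<noteq> 0" "vanishes_on g0 S" using conchoid_equation by blast
  have branch: "plane_curve (R \<sigma>)" "rational_curve (R \<sigma>)" "infinite (R \<sigma>)"
    "vanishes_on g0 (R \<sigma>)" if \<sigma>: "\<sigma> ^ 2 * n = const_rat (d ^ 2)" for \<sigma>
  proof -
    have inf: "infinite (rat_image (branch \<sigma>))"
      using infinite_rat_image[OF branch_nonconstant[OF \<sigma>]] by simp
    have van: "vanishes_on g0 (rat_image (branch \<sigma>))" by (rule vanishes_on_branch[OF \<sigma> g0(2)])
    note curve = prime_vanishing_curve[OF inf prime_vanishing_rat_image g0(1) van]
    show "plane_curve (R \<sigma>)" using curve by (simp add: R_def)
    have "parametrizes (branch \<sigma>) (R \<sigma>)"
      using branch_nonconstant[OF \<sigma>] by (simp add: parametrizes_def R_def rat_image_def)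
    then show "rational_curve (R \<sigma>)" using curve unfolding rational_curve_def R_def by blast
    show "infinite (R \<sigma>)" unfolding R_def using inf subset_zariski_closure infinite_super by blast
    show "vanishes_on g0 (R \<sigma>)" using van by (simp add: R_def)
  qed
  have \<rho>': "(- \<rho>) ^ 2 * n = const_rat (d ^ 2)" using \<rho> by simp
  have D: "D = R \<rho> \<union> R (- \<rho>)"
  proof
    have "R \<sigma> \<subseteq> D" if \<sigma>: "\<sigma> ^ 2 * n = const_rat (d ^ 2)" for \<sigma>
    proof (rule zariski_closed_subsetI)
      show "vanishes_on g (R \<sigma>)" if "vanishes_on g D" for g
        using that vanishes_on_branch[OF \<sigma>] by (simp add: D_def R_def)
    qed (simp add: D_def)
    then show "R \<rho> \<union> R (- \<rho>) \<subseteq> D" using \<rho> \<rho>' by blast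
    show "D \<subseteq> R \<rho> \<union> R (- \<rho>)"
    proof (rule zariski_closed_subsetI)
      show "zariski_closed (R \<rho> \<union> R (- \<rho>))" by (simp add: R_def zariski_closed_Un)
      show "vanishes_on g D" if "vanishes_on g (R \<rho> \<union> R (- \<rho>))" for g
      proof -
        have "vanishes_on g (R \<rho>)" "vanishes_on g (R (- \<rho>))" using that by (auto simp: vanishes_on_def)
        then have "vanishes_on g (rat_image (branch \<rho>) \<union> rat_image (branch (- \<rho>)))"
          unfolding R_def vanishes_on_closure by (auto simp: vanishes_on_def)
        then show ?thesis by (simp add: D_def vanishes_on_conchoid_iff_branches[OF \<rho>])
      qed
    qed
  qed
  show "plane_curve D" unfolding D by (intro plane_curve_Un branch \<rho> \<rho>')
  show "rational_curve D \<or> (\<not> zariski_irreducible D \<and> card (irreducible_components D) = 2 \<and>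
        (\<forall>Z \<in> irreducible_components D. rational_curve Z))"
  proof (cases "R \<rho> = R (- \<rho>)")
    case True
    then show ?thesis using branch(2)[OF \<rho>] D by simp
  next
    case False
    have prime: "prime_vanishing (R \<sigma>)" "zariski_closed (R \<sigma>)" for \<sigma>
      using prime_vanishing_rat_image by (simp_all add: R_def)
    have ns: "\<not> R \<rho> \<subseteq> R (- \<rho>)" "\<not> R (- \<rho>) \<subseteq> R \<rho>"
      using False prime_vanishing_no_proper_inclusion[OF branch(3)[OF \<rho>] prime(1) branch(3)[OF \<rho>'] prime(1)
          prime(2) prime(2) g0(1) branch(4)[OF \<rho>']]
        prime_vanishing_no_proper_inclusion[OF branch(3)[OF \<rho>'] prime(1) branch(3)[OF \<rho>] prime(1)
          prime(2) prime(2) g0(1) branch(4)[OF \<rho>]] by auto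
    have "zariski_irreducible (R \<rho>)" "zariski_irreducible (R (- \<rho>))"
      using branch(2)[OF \<rho>] branch(2)[OF \<rho>'] by (auto simp: rational_curve_def)
    note comp = irreducible_components_Un[OF this ns]
    show ?thesis using comp False branch(2)[OF \<rho>] branch(2)[OF \<rho>'] by (simp add: D)
  qed
qed

end

theorem corollary3p7:
  fixes f :: "'a::{alg_closed_field, field_char_0} poly poly"
    and a b d j :: 'a
    and C D :: "('a \<times> 'a) set"
  assumes "d \<noteq> 0"
    and "irreducible f"
    and C_def: "C = zero_locus {f}"
    and "rational_curve C"
    and "j ^ 2 = -1"
    and "C \<noteq> {(y1, y2). y1 + j * y2 = 0}"
    and "C \<noteq> {(y1, y2). y1 - j * y2 = 0}"
    and "C \<noteq> {(y1, y2). (y1 - a) ^ 2 + (y2 - b) ^ 2 = d ^ 2}"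
    and "\<And>u v. (u, v) \<noteq> (0, 0) \<Longrightarrow> C \<noteq> {(y1, y2). u * (y1 - a) + v * (y2 - b) = 0}"
    and D_def: "D = conchoid f (a, b) d"
  shows "plane_curve D \<and>
    (rational_curve D
     \<or> (\<not> zariski_irreducible D \<and> card (irreducible_components D) = 2 \<and>
        (\<forall>Z \<in> irreducible_components D. rational_curve Z))
     \<or> (zariski_irreducible D \<and> \<not> rational_curve D))"
proof -
  obtain r1 r2 where "parametrizes (r1, r2) C" using assms(4) unfolding rational_curve_def by auto
  then interpret rational_curve_with_focus f a b d r1 r2
    using assms(1,2,8,9)
    by unfold_locales (auto simp: parametrizes_def C_def rat_image_def)
  have D: "D = zariski_closure S" by (simp add: D_def conchoid_eq_closure)
  show ?thesis
  proof (cases "\<exists>m. n = m ^ 2")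
    case True
    then obtain m where m: "n = m ^ 2" by blast
    have "n \<noteq> 0"
    proof
      assume "n = 0"
      then have "rat_value n t 0" for t using rat_value_const[of 0 t] by simp
      then have "\<not> (at_param t y1 y2 \<and> N y1 y2 \<noteq> 0)" for t y1 y2
        using rat_value_n rat_value_unique by metis
      then have "{t. \<exists>y1 y2. at_param t y1 y2 \<and> N y1 y2 \<noteq> 0} = {}" by blast
      then show False using infinite_anisotropic_params by (metis finite.emptyI)
    qed
    then have "(const_rat d / m) ^ 2 * n = const_rat (d ^ 2)"
      unfolding m by (simp add: power_divide power2_eq_square flip: to_fract_mult)
    then show ?thesis using conchoid_split_case unfolding D by blast
  next
    case False
    obtain g0 where "g0 \<noteq> 0" "vanishes_on g0 S" using conchoid_equation by blast
    then show ?thesis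
      using prime_vanishing_curve[OF infinite_conchoid_points prime_vanishing_conchoid_points] False
      unfolding D by blast
  qed
qed

end
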